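(* Let $\Omega\Subset\mathbb C^N$ be an irreducible bounded symmetric domain in its Harish-Chandra realization, let $k$ be an integer with $1\le k\le \mathrm{rank}(\Omega)$, let $n\ge 2$, and let $f:(\mathbb B^n,k g_{\mathbb B^n})\to(\Omega,g_\Omega)$ be a holomorphic isometric embedding with $f(\mathbf 0)=\mathbf 0$. Then, for every $1\le m\le n-1$, $f$ induces an injective map $$f_m^\sharp:\mathrm{Gr}(m,\mathbb C^n)\to \mathrm{Gr}(N-n+m,\mathbb C^N),\qquad f_m^\sharp(V):=\ker\big(\mathbf A\,\overline{Jf(\mathbf 0)}^T\big)\quad\text{for } V=\ker(\mathbf A)\in\mathrm{Gr}(m,\mathbb C^n),$$ where $\mathbf A\in M(n-m,n;\mathbb C)$ is a matrix of rank $n-m$. In addition, for any $V\in \mathrm{Gr}(m,\mathbb C^n)$, $$f_m^\sharp(V)=df_{\mathbf 0}(V)\oplus\ker\overline{Jf(\mathbf 0)}^T,$$ which is a complex $(N-n+m)$-dimensional vector subspace of $\mathbb C^N$. Moreover, for any $1\le m\le n-1$, any complex $m$-dimensional vector subspace $V$ of $\mathbb C^n$ and any $\mathbf v\in\mathbb B^n$, $$f((V+\mathbf v)\cap\mathbb B^n)=(f_m^\sharp(V)+Jf(\mathbf 0)\mathbf v)\cap f(\mathbb B^n)\subseteq (f_m^\sharp(V)+Jf(\mathbf 0)\mathbf v)\cap\Omega$$ and $$f((V+\mathbf v)\cap\mathbb B^n)=(f_m^\sharp(V)+f(\mathbf v))\cap f(\mathbb B^n)\subseteq (f_m^\sharp(V)+f(\mathbf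 v))\cap\Omega .$$ In other words, for any $1\le m\le n-1$ and any complex $m$-dimensional affine-linear subspace $\Lambda_m$ of $\mathbb C^n$ with $\Lambda_m\cap\mathbb B^n\ne\varnothing$, there exists a complex $(N-n+m)$-dimensional affine-linear subspace $\Pi_{N-n+m}$ of $\mathbb C^N$ such that $f(\Lambda_m\cap\mathbb B^n)\subset\Pi_{N-n+m}\cap\Omega$. In particular, $f$ takes hyperplanes into hyperplanes, i.e. for every complex affine hyperplane $\Lambda$ of $\mathbb C^n$ meeting $\mathbb B^n$, $f(\Lambda\cap\mathbb B^n)$ is contained in a complex affine hyperplane of $\mathbb C^N$.
   Context: $\mathbb B^n=\{z\in\mathbb C^n:\sum_j|z_j|^2<1\}$. $\mathrm{Gr}(m,W)$ is the Grassmannian of complex $m$-dimensional subspaces of the complex vector space $W$; $M(a,b;\mathbb C)$ is the set of complex $a\times b$ matrices. Vectors are identified with column vectors. For a holomorphic map $f=(f_1,\dots,f_N)$ on a domain in $\mathbb C^n$, $Jf(\zeta_0)=\big(\frac{\partial f_i}{\partial\zeta_j}(\zeta_0)\big)\in M(N,n;\mathbb C)$ is the complex Jacobian matrix, and $df_{\mathbf 0}:\mathbb C^n\cong T_{\mathbf 0}(\mathbb B^n)\to T_{\mathbf 0}(\Omega)\cong\mathbb C^N$ is $\mathbf v\mapsto Jf(\mathbf 0)\mathbf v$. For an irreducible bounded symmetric domain $\Omega\Subset\mathbb C^N$ in its Harish-Chandra realization, $g_\Omega$ denotes the canonical Kähler–Einstein metric on $\Omega$, normalized so that minimal disks of $\Omega$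 have constant Gaussian curvature $-2$. Its Kähler form is $\omega_{g_\Omega}=-\sqrt{-1}\,\partial\overline\partial\log h_\Omega(z,z)$, where $h_\Omega(z,\xi)$ is a polynomial in $(z,\overline\xi)$ (the Bergman kernel of $\Omega$ is a positive constant times a negative integer power of $h_\Omega$). The Harish-Chandra coordinates are chosen such that $h_\Omega(z,\xi)=1-\sum_{j=1}^N z_j\overline{\xi_j}+\sum_l(-1)^{\deg G_l}G_l(z)\overline{G_l(\xi)}$ for finitely many homogeneous polynomials $G_l$ of degree $\ge2$ (none if $\Omega=\mathbb B^N$); in particular $h_{\mathbb B^n}(z,\xi)=1-\sum_j z_j\overline{\xi_j}$. A holomorphic isometric embedding $f:(\mathbb B^n,kg_{\mathbb B^n})\to(\Omega,g_\Omega)$ is a holomorphic embedding with $f^*g_\Omega=k g_{\mathbb B^n}$. *)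

theory Defs
  imports "HOL-Analysis.Analysis"
begin

text \<open>Points of complex \<open>n\<close>-space are the vectors of type \<open>complex^'n\<close>, so \<open>n = CARD('n)\<close>, and the
  unit ball is \<open>ball 0 1\<close>. Plain \<open>subspace\<close> and \<open>dim\<close> refer to the real structure;
  \<open>vec.subspace\<close> and \<open>vec.dim\<close> refer to the complex one.\<close>

definition holo_fun :: "(complex^'n) set \<Rightarrow> (complex^'n \<Rightarrow> complex) \<Rightarrow> bool" where
  "holo_fun S F \<longleftrightarrow>
     (\<forall>z\<in>S. \<exists>D. (F has_derivative D) (at z) \<and> (\<forall>c v. D (c *s v) = c * D v))"

definition holo_map :: "(complex^'n) set \<Rightarrow> (complex^'n \<Rightarrow> complex^'m) \<Rightarrow> bool" where
  "holo_map S f \<longleftrightarrow> (\<forall>i. holo_fun S (\<lambda>z. f z $ i))"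

definition cpartial :: "'n::finite \<Rightarrow> (complex^'n \<Rightarrow> complex) \<Rightarrow> complex^'n \<Rightarrow> complex" where
  "cpartial j F z = deriv (\<lambda>t. F (z + t *s axis j 1)) 0"

definition cjacobian :: "(complex^'n \<Rightarrow> complex^'m) \<Rightarrow> complex^'n \<Rightarrow> complex^'n^'m" where
  "cjacobian f z = (\<chi> i j. cpartial j (\<lambda>w. f w $ i) z)"

definition holomorphic_embedding ::
    "(complex^'n) set \<Rightarrow> (complex^'m) set \<Rightarrow> (complex^'n \<Rightarrow> complex^'m) \<Rightarrow> bool" where
  "holomorphic_embedding S T f \<longleftrightarrow>
     holo_map S f \<and> f ` S \<subseteq> T \<and>
     (\<forall>z\<in>S. inj (\<lambda>v. cjacobian f z *v v)) \<and>
     (\<exists>g. homeomorphism S (f ` S) f g)"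

definition biholomorphic_map ::
    "(complex^'n) set \<Rightarrow> (complex^'m) set \<Rightarrow> (complex^'n \<Rightarrow> complex^'m) \<Rightarrow> bool" where
  "biholomorphic_map S T f \<longleftrightarrow>
     bij_betw f S T \<and> holo_map S f \<and> holo_map T (inv_into S f)"

abbreviation automorphism :: "(complex^'n) set \<Rightarrow> (complex^'n \<Rightarrow> complex^'n) \<Rightarrow> bool" where
  "automorphism S \<equiv> biholomorphic_map S S"

definition symmetry_at :: "(complex^'n) set \<Rightarrow> complex^'n \<Rightarrow> (complex^'n \<Rightarrow> complex^'n) \<Rightarrow> bool" where
  "symmetry_at \<Omega> p \<sigma> \<longleftrightarrow>
     automorphism \<Omega> \<sigma> \<and> (\<forall>z\<in>\<Omega>. \<sigma> (\<sigma> z) = z) \<and> \<sigma> p = p \<and>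
     (\<exists>e>0. \<forall>z\<in>\<Omega> \<inter> ball p e. \<sigma> z = z \<longrightarrow> z = p)"

definition bounded_symmetric_domain :: "(complex^'n) set \<Rightarrow> bool" where
  "bounded_symmetric_domain \<Omega> \<longleftrightarrow>
     open \<Omega> \<and> connected \<Omega> \<and> bounded \<Omega> \<and> \<Omega> \<noteq> {} \<and> (\<forall>p\<in>\<Omega>. \<exists>\<sigma>. symmetry_at \<Omega> p \<sigma>)"

text \<open>\<open>D\<close> is a product of a set in the coordinates indexed by \<open>I\<close> and a set in the
  remaining coordinates.\<close>

definition splits_along :: "'n set \<Rightarrow> (complex^'n) set \<Rightarrow> bool" where
  "splits_along I D \<longleftrightarrow>
     (\<forall>z\<in>D. \<forall>w\<in>D. (\<chi> i. if i \<in> I then z $ i else w $ i) \<in> D)"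

definition irreducible_bsd :: "(complex^'n) set \<Rightarrow> bool" where
  "irreducible_bsd \<Omega> \<longleftrightarrow>
     bounded_symmetric_domain \<Omega> \<and>
     \<not> (\<exists>D f I. bounded_symmetric_domain D \<and> biholomorphic_map \<Omega> D f \<and>
              I \<noteq> {} \<and> I \<noteq> (UNIV :: 'n set) \<and> splits_along I D)"

text \<open>The Lie algebra of the automorphism group of \<open>\<Omega>\<close>, as the real Lie algebra of complete
  holomorphic vector fields. Of a field only the values on \<open>\<Omega>\<close> are relevant.\<close>

definition complete_holo_field :: "(complex^'n) set \<Rightarrow> (complex^'n \<Rightarrow> complex^'n) \<Rightarrow> bool" where
  "complete_holo_field \<Omega> X \<longleftrightarrow>
     holo_map \<Omega> X \<and>
     (\<exists>\<Phi> :: real \<Rightarrow> complex^'n \<Rightarrow> complex^'n.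
        (\<forall>t. automorphism \<Omega> (\<Phi> t)) \<and> (\<forall>z\<in>\<Omega>. \<Phi> 0 z = z) \<and>
        (\<forall>z\<in>\<Omega>. \<forall>t. ((\<lambda>s. \<Phi> s z) has_vector_derivative X (\<Phi> t z)) (at t)))"

text \<open>The \<open>-1\<close> eigenspace \<open>\<pp>\<close> of the involution induced by the symmetry at the base point \<open>p\<close>.
  Evaluation at \<open>p\<close> is a real isomorphism of \<open>\<pp>\<close> onto the tangent space at \<open>p\<close>.\<close>

definition cartan_p :: "(complex^'n) set \<Rightarrow> complex^'n \<Rightarrow> (complex^'n \<Rightarrow> complex^'n) set" where
  "cartan_p \<Omega> p =
     {X. complete_holo_field \<Omega> X \<and>
         (\<forall>\<sigma>. symmetry_at \<Omega> p \<sigma> \<longrightarrow> (\<forall>z\<in>\<Omega>. cjacobian \<sigma> z *v X z = - X (\<sigma> z)))}"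

definition field_bracket ::
    "(complex^'n \<Rightarrow> complex^'n) \<Rightarrow> (complex^'n \<Rightarrow> complex^'n) \<Rightarrow> complex^'n \<Rightarrow> complex^'n" where
  "field_bracket X Y z = cjacobian Y z *v X z - cjacobian X z *v Y z"

text \<open>Let \<open>J\<close> be the invariant complex structure of \<open>\<pp>\<close>, given by \<open>(J X)(0) = i X(0)\<close>. The
  abelian subalgebra \<open>\<pp>\<^sup>+\<close> (the \<open>+i\<close> eigenspace of \<open>J\<close> in the complexification) consists of
  the \<open>X - i J X\<close>, which act as holomorphic vector fields. The Harish-Chandra embedding is the
  inverse of \<open>v \<mapsto> exp(v)\<cdot>o\<close> on \<open>\<pp>\<^sup>+\<close>. With \<open>\<pp>\<^sup>+\<close> identified with the tangent space at \<open>0\<close>,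
  a domain of \<open>\<complex>\<^sup>N\<close> is therefore its own Harish-Chandra image precisely if \<open>\<pp>\<^sup>+\<close> acts by
  translations, i.e. by constant vector fields. Below, \<open>Y\<close> is \<open>J X\<close>.\<close>

definition harish_chandra_realization :: "(complex^'n) set \<Rightarrow> bool" where
  "harish_chandra_realization \<Omega> \<longleftrightarrow>
     bounded_symmetric_domain \<Omega> \<and> 0 \<in> \<Omega> \<and>
     (\<forall>X\<in>cartan_p \<Omega> 0. \<forall>Y\<in>cartan_p \<Omega> 0. Y 0 = \<i> *s X 0 \<longrightarrow>
        (\<forall>z\<in>\<Omega>. X z - \<i> *s Y z = X 0 - \<i> *s Y 0))"

text \<open>The maximal dimension of an abelian subspace of \<open>\<pp>\<close>. A subspace of \<open>\<pp>\<close> is represented by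
  its image \<open>A\<close> under evaluation at \<open>0\<close>, and \<open>dim\<close> is the real dimension.\<close>

definition bsd_rank :: "(complex^'n) set \<Rightarrow> nat" where
  "bsd_rank \<Omega> =
     Max {dim A | A. subspace A \<and>
        (\<forall>X\<in>cartan_p \<Omega> 0. \<forall>Y\<in>cartan_p \<Omega> 0. X 0 \<in> A \<longrightarrow> Y 0 \<in> A \<longrightarrow>
           (\<forall>z\<in>\<Omega>. field_bracket X Y z = 0))}"

text \<open>Wirtinger derivatives: \<open>wirt F z u\<close> is \<open>\<Sum>i. u\<^sub>i \<partial>F/\<partial>z\<^sub>i\<close> and \<open>wirt_bar F z v\<close> is
  \<open>\<Sum>j. cnj v\<^sub>j \<partial>F/\<partial>(cnj z\<^sub>j)\<close>.\<close>

definition wirt :: "(complex^'n \<Rightarrow> complex) \<Rightarrow> complex^'n \<Rightarrow> complex^'n \<Rightarrow> complex" where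
  "wirt F z u = (frechet_derivative F (at z) u - \<i> * frechet_derivative F (at z) (\<i> *s u)) / 2"

definition wirt_bar :: "(complex^'n \<Rightarrow> complex) \<Rightarrow> complex^'n \<Rightarrow> complex^'n \<Rightarrow> complex" where
  "wirt_bar F z v = (frechet_derivative F (at z) v + \<i> * frechet_derivative F (at z) (\<i> *s v)) / 2"

definition ddbar :: "(complex^'n \<Rightarrow> real) \<Rightarrow> complex^'n \<Rightarrow> complex^'n \<Rightarrow> complex^'n \<Rightarrow> complex" where
  "ddbar \<phi> z u v = wirt (\<lambda>w. wirt_bar (\<lambda>x. complex_of_real (\<phi> x)) w v) z u"

primrec ck_on :: "nat \<Rightarrow> 'a::euclidean_space set \<Rightarrow> ('a \<Rightarrow> 'b::real_normed_vector) \<Rightarrow> bool" where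
  "ck_on 0 S F \<longleftrightarrow> continuous_on S F"
| "ck_on (Suc k) S F \<longleftrightarrow>
     (\<forall>x\<in>S. F differentiable (at x)) \<and> (\<forall>v. ck_on k S (\<lambda>x. frechet_derivative F (at x) v))"

text \<open>\<open>g z u v\<close> stands for \<open>\<Sum>i j. g\<^sub>i\<^sub>j(z) u\<^sub>i cnj v\<^sub>j\<close>. The Kaehler form is
  \<open>i \<Sum>i j. g\<^sub>i\<^sub>j dz\<^sub>i \<and> d(cnj z\<^sub>j)\<close>, so the associated Riemannian metric is
  \<open>2 Re (g z u v)\<close>.\<close>

type_synonym 'n metric = "complex^'n \<Rightarrow> complex^'n \<Rightarrow> complex^'n \<Rightarrow> complex"

definition hermitian_metric :: "(complex^'n) set \<Rightarrow> 'n::finite metric \<Rightarrow> bool" where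
  "hermitian_metric \<Omega> g \<longleftrightarrow>
     (\<forall>z\<in>\<Omega>. (\<forall>u u' v. g z (u + u') v = g z u v + g z u' v) \<and>
            (\<forall>c u v. g z (c *s u) v = c * g z u v) \<and>
            (\<forall>u v. g z v u = cnj (g z u v)) \<and>
            (\<forall>u. u \<noteq> 0 \<longrightarrow> Re (g z u u) > 0)) \<and>
     (\<forall>k u v. ck_on k \<Omega> (\<lambda>z. g z u v))"

definition kaehler_metric :: "(complex^'n) set \<Rightarrow> 'n::finite metric \<Rightarrow> bool" where
  "kaehler_metric \<Omega> g \<longleftrightarrow>
     hermitian_metric \<Omega> g \<and>
     (\<forall>z\<in>\<Omega>. \<forall>u v w. wirt (\<lambda>x. g x w v) z u = wirt (\<lambda>x. g x u v) z w)"

definition metric_det :: "'n::finite metric \<Rightarrow> complex^'n \<Rightarrow> real" where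
  "metric_det g z = Re (det (\<chi> i j. g z (axis i 1) (axis j 1) :: complex^'n^'n))"

text \<open>The Ricci form has coefficients \<open>- ddbar (log det g)\<close>; on a bounded symmetric domain the
  Einstein constant is negative.\<close>

definition kaehler_einstein :: "(complex^'n) set \<Rightarrow> 'n::finite metric \<Rightarrow> bool" where
  "kaehler_einstein \<Omega> g \<longleftrightarrow>
     kaehler_metric \<Omega> g \<and>
     (\<exists>l>0. \<forall>z\<in>\<Omega>. \<forall>u v. - ddbar (\<lambda>w. ln (metric_det g w)) z u v = - of_real l * g z u v)"

definition aut_invariant :: "(complex^'n) set \<Rightarrow> 'n::finite metric \<Rightarrow> bool" where
  "aut_invariant \<Omega> g \<longleftrightarrow>
     (\<forall>\<phi>. automorphism \<Omega> \<phi> \<longrightarrow>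
        (\<forall>z\<in>\<Omega>. \<forall>u v. g (\<phi> z) (cjacobian \<phi> z *v u) (cjacobian \<phi> z *v v) = g z u v))"

text \<open>A polydisk of dimension \<open>card J\<close> is parametrized by a map on the unit polydisk of \<open>\<complex>\<^sup>N\<close>
  that depends on the coordinates in \<open>J\<close> only.\<close>

definition unit_polydisk :: "(complex^'n) set" where
  "unit_polydisk = {z. \<forall>j. cmod (z $ j) < 1}"

definition coord_vf :: "(complex^'n \<Rightarrow> complex^'m) \<Rightarrow> 'n::finite \<Rightarrow> complex^'n \<Rightarrow> complex^'m" where
  "coord_vf \<Phi> a z = (\<chi> i. cpartial a (\<lambda>w. \<Phi> w $ i) z)"

text \<open>Vanishing of the second fundamental form: the Chern (= Levi-Civita) connection satisfies
  \<open>g (\<nabla>\<^sub>u w) v = g (\<partial>\<^sub>u w) v + (\<partial>\<^sub>u g) w v\<close>, and its values on coordinate fields are to have no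
  component normal to the image of \<open>\<Phi>\<close>.\<close>

definition totally_geodesic ::
    "'n::finite metric \<Rightarrow> 'n set \<Rightarrow> (complex^'n \<Rightarrow> complex^'n) \<Rightarrow> bool" where
  "totally_geodesic g J \<Phi> \<longleftrightarrow>
     (\<forall>z\<in>unit_polydisk. \<forall>a\<in>J. \<forall>b\<in>J. \<forall>v.
        (\<forall>c\<in>J. g (\<Phi> z) (coord_vf \<Phi> c z) v = 0) \<longrightarrow>
        g (\<Phi> z) (coord_vf (coord_vf \<Phi> b) a z) v
          + wirt (\<lambda>x. g x (coord_vf \<Phi> b z) v) (\<Phi> z) (coord_vf \<Phi> a z) = 0)"

text \<open>Maximal polydisks, as in the Polydisk Theorem: totally geodesic complex submanifolds of
  dimension \<open>rank \<Omega>\<close> which are isometric to a product of Poincare disks of equal curvature.\<close>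

definition maximal_polydisk ::
    "(complex^'n) set \<Rightarrow> 'n::finite metric \<Rightarrow> 'n set \<Rightarrow> (complex^'n \<Rightarrow> complex^'n) \<Rightarrow> bool" where
  "maximal_polydisk \<Omega> g J \<Phi> \<longleftrightarrow>
     card J = bsd_rank \<Omega> \<and>
     holo_map unit_polydisk \<Phi> \<and> \<Phi> ` unit_polydisk \<subseteq> \<Omega> \<and>
     (\<forall>z. \<Phi> z = \<Phi> (\<chi> j. if j \<in> J then z $ j else 0)) \<and>
     inj_on \<Phi> {z \<in> unit_polydisk. \<forall>j. j \<notin> J \<longrightarrow> z $ j = 0} \<and>
     (\<exists>c>0. \<forall>z\<in>unit_polydisk. \<forall>a\<in>J. \<forall>b\<in>J.
        g (\<Phi> z) (coord_vf \<Phi> a z) (coord_vf \<Phi> b z)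
          = (if a = b then of_real (c / (1 - (cmod (z $ a))\<^sup>2)\<^sup>2) else 0)) \<and>
     totally_geodesic g J \<Phi>"

text \<open>Minimal disks are the factor disks of maximal polydisks.\<close>

definition minimal_disk ::
    "(complex^'n) set \<Rightarrow> 'n::finite metric \<Rightarrow> (complex \<Rightarrow> complex^'n) \<Rightarrow> bool" where
  "minimal_disk \<Omega> g \<psi> \<longleftrightarrow>
     (\<exists>J \<Phi> j w. maximal_polydisk \<Omega> g J \<Phi> \<and> j \<in> J \<and> w \<in> unit_polydisk \<and>
        \<psi> = (\<lambda>t. \<Phi> (\<chi> i. if i = j then t else w $ i)))"

definition laplacian :: "(complex \<Rightarrow> real) \<Rightarrow> complex \<Rightarrow> real" where
  "laplacian u t =
     (deriv ^^ 2) (\<lambda>x. u (t + of_real x)) 0 + (deriv ^^ 2) (\<lambda>y. u (t + \<i> * of_real y)) 0"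

text \<open>The Riemannian metric induced on a disk \<open>\<psi>\<close> is \<open>\<lambda> |dt|\<^sup>2\<close> with
  \<open>\<lambda> = 2 g(\<psi>', \<psi>')\<close>; its Gaussian curvature is \<open>- laplacian (ln \<lambda>) / (2 \<lambda>)\<close>.\<close>

definition conformal_factor :: "'n::finite metric \<Rightarrow> (complex \<Rightarrow> complex^'n) \<Rightarrow> complex \<Rightarrow> real" where
  "conformal_factor g \<psi> t =
     (let d = (\<chi> i. deriv (\<lambda>s. \<psi> s $ i) t) in 2 * Re (g (\<psi> t) d d))"

definition gaussian_curvature :: "'n::finite metric \<Rightarrow> (complex \<Rightarrow> complex^'n) \<Rightarrow> complex \<Rightarrow> real" where
  "gaussian_curvature g \<psi> t =
     - laplacian (\<lambda>s. ln (conformal_factor g \<psi> s)) t / (2 * conformal_factor g \<psi> t)"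

definition canonical_KE_metric :: "(complex^'n) set \<Rightarrow> 'n::finite metric \<Rightarrow> bool" where
  "canonical_KE_metric \<Omega> g \<longleftrightarrow>
     kaehler_einstein \<Omega> g \<and> aut_invariant \<Omega> g \<and>
     (\<forall>\<psi>. minimal_disk \<Omega> g \<psi> \<longrightarrow> (\<forall>t\<in>ball 0 1. gaussian_curvature g \<psi> t = - 2))"

definition bergman_space :: "(complex^'n) set \<Rightarrow> (complex^'n \<Rightarrow> complex) set" where
  "bergman_space \<Omega> =
     {F. holo_fun \<Omega> F \<and> set_integrable lborel \<Omega> (\<lambda>z. (cmod (F z))\<^sup>2)}"

definition bergman_kernel ::
    "(complex^'n) set \<Rightarrow> (complex^'n \<Rightarrow> complex^'n \<Rightarrow> complex) \<Rightarrow> bool" where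
  "bergman_kernel \<Omega> K \<longleftrightarrow>
     (\<forall>\<xi>\<in>\<Omega>. (\<lambda>z. K z \<xi>) \<in> bergman_space \<Omega> \<and>
        (\<forall>F\<in>bergman_space \<Omega>. F \<xi> = (LINT z:\<Omega>|lborel. F z * cnj (K z \<xi>))))"

definition homogeneous_poly :: "nat \<Rightarrow> (complex^'n \<Rightarrow> complex) \<Rightarrow> bool" where
  "homogeneous_poly d G \<longleftrightarrow>
     (\<exists>c :: ('n \<Rightarrow> nat) \<Rightarrow> complex.
        \<forall>z. G z = (\<Sum>\<alpha> | (\<Sum>i\<in>UNIV. \<alpha> i) = d. c \<alpha> * (\<Prod>i\<in>UNIV. z $ i ^ \<alpha> i)))"

definition ball_h :: "complex^'n \<Rightarrow> complex^'n \<Rightarrow> complex" where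
  "ball_h z \<xi> = 1 - (\<Sum>j\<in>UNIV. z $ j * cnj (\<xi> $ j))"

text \<open>The metric with Kaehler form \<open>-i \<partial>\<partial>bar log h(z,z)\<close>.\<close>

definition log_metric :: "(complex^'n \<Rightarrow> complex^'n \<Rightarrow> complex) \<Rightarrow> 'n::finite metric" where
  "log_metric h z u v = - ddbar (\<lambda>w. ln (Re (h w w))) z u v"

abbreviation ball_metric :: "'n::finite metric" where
  "ball_metric \<equiv> log_metric ball_h"

text \<open>The second conjunct also expresses the choice of the Harish-Chandra coordinates, which the
  realization fixes only up to a linear change.\<close>

definition h_polynomial ::
    "(complex^'n) set \<Rightarrow> 'n::finite metric \<Rightarrow> (complex^'n \<Rightarrow> complex^'n \<Rightarrow> complex) \<Rightarrow> bool" where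
  "h_polynomial \<Omega> g h \<longleftrightarrow>
     (\<forall>z\<in>\<Omega>. \<forall>u v. g z u v = log_metric h z u v) \<and>
     (\<exists>(L::nat) d G.
        (\<forall>l<L. 2 \<le> d l \<and> homogeneous_poly (d l) (G l)) \<and>
        (\<Omega> = ball 0 1 \<longrightarrow> L = 0) \<and>
        (\<forall>z \<xi>. h z \<xi> = 1 - (\<Sum>j\<in>UNIV. z $ j * cnj (\<xi> $ j))
                      + (\<Sum>l<L. (- 1) ^ d l * G l z * cnj (G l \<xi>)))) \<and>
     (\<exists>K (c::real) (p::nat). bergman_kernel \<Omega> K \<and> c > 0 \<and> p > 0 \<and>
        (\<forall>z\<in>\<Omega>. \<forall>\<xi>\<in>\<Omega>. K z \<xi> * h z \<xi> ^ p = of_real c))"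

definition holo_isometric_embedding ::
    "(complex^'n) set \<Rightarrow> 'n::finite metric \<Rightarrow> real \<Rightarrow> (complex^'m) set \<Rightarrow> 'm::finite metric
       \<Rightarrow> (complex^'n \<Rightarrow> complex^'m) \<Rightarrow> bool" where
  "holo_isometric_embedding S g\<^sub>S k T g\<^sub>T f \<longleftrightarrow>
     holomorphic_embedding S T f \<and>
     (\<forall>z\<in>S. \<forall>u v. g\<^sub>T (f z) (cjacobian f z *v u) (cjacobian f z *v v) = of_real k * g\<^sub>S z u v)"

definition grassmannian :: "nat \<Rightarrow> (complex^'n) set set" where
  "grassmannian m = {V. vec.subspace V \<and> vec.dim V = m}"

definition affine_subspaces :: "nat \<Rightarrow> (complex^'n) set set" where
  "affine_subspaces m = {(+) p ` V | p V. V \<in> grassmannian m}"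

definition ctranspose :: "complex^'n^'m \<Rightarrow> complex^'m^'n" where
  "ctranspose M = (\<chi> i j. cnj (M $ j $ i))"

definition mat_ker :: "complex^'n^'m \<Rightarrow> (complex^'n) set" where
  "mat_ker M = {v. M *v v = 0}"

text \<open>Since the number \<open>n - m\<close> of rows of the matrix \<open>\<A>\<close> varies inside the statement, \<open>\<A>\<close> is
  given as the list of its rows.\<close>

definition rows_mult :: "(complex^'n) list \<Rightarrow> complex^'m^'n \<Rightarrow> (complex^'m) list" where
  "rows_mult A B = map (\<lambda>a. a v* B) A"

definition rows_ker :: "(complex^'n) list \<Rightarrow> (complex^'n) set" where
  "rows_ker A = {v. \<forall>a\<in>set A. (\<Sum>j\<in>UNIV. a $ j * v $ j) = 0}"

definition full_rank_rows :: "nat \<Rightarrow> (complex^'n) list \<Rightarrow> bool" where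
  "full_rank_rows r A \<longleftrightarrow> length A = r \<and> vec.dim (set A) = r"

text \<open>Independence of the choice of \<open>A\<close> is not part of this definition.\<close>

definition f_sharp ::
    "(complex^'n \<Rightarrow> complex^'N) \<Rightarrow> nat \<Rightarrow> (complex^'n) set \<Rightarrow> (complex^'N) set" where
  "f_sharp f m V =
     (THE W. \<exists>A. full_rank_rows (CARD('n) - m) A \<and> V = rows_ker A \<and>
               W = rows_ker (rows_mult A (ctranspose (cjacobian f 0))))"

end

theory Submission
  imports Defs "HOL-Complex_Analysis.Conformal_Mappings"
begin

text \<open>
  The isometry condition says that \<open>log h(f(z), f(z))\<close> and \<open>k log(1 - |z|\<^sup>2)\<close> have the same mixed
  derivatives. Neither has purely holomorphic terms at the origin, so the two agree and polarization
  gives \<open>h(f(z), f(w)) = (1 - \<langle>z, w\<rangle>)\<^sup>k\<close>. Since the \<open>G\<^sub>l\<close> have no linear part, differentiating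
  once in \<open>cnj w\<close> at \<open>w = 0\<close> leaves the linear identity \<open>J\<^sup>* f(z) = k z\<close> for \<open>J = Jf(0)\<close>,
  whence \<open>J\<^sup>* J = k I\<close>. As \<open>f\<^sub>m\<^sup>\<sharp>(V)\<close> is the preimage of \<open>V\<close> under \<open>J\<^sup>*\<close>, all claims follow
  by linear algebra.
\<close>

text \<open>All the analysis is done in one complex variable: the metrics are compared only along
  complex lines through the origin, and polarization runs along the line joining two points.
  \<open>disc_potential\<close> assumes nothing about the zeros of \<open>H\<close>, so the
  curvature identity is freed of its denominators before it is polarized. Quotients by
  \<open>H\<close> occur only near \<open>z = 0\<close>, where \<open>H 0 w = 1\<close>, and
  analytic continuation then reaches the whole disc. The logarithm of \<open>h\<close> on the
  diagonal of \<Omega> makes sense because the Bergman kernel relation forbids zeros of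
  \<open>h\<close> there. The integration constants come from \<open>f 0 = 0\<close>: every term of
  \<open>h\<close> except the leading 1 vanishes as soon as one argument is 0.\<close>

section \<open>Polarization\<close>

text \<open>These are finite sums of products a(z) cnj(b(w)). Generating them inductively gives the
  calculus of functions holomorphic in \<open>z\<close> and antiholomorphic in \<open>w\<close> by
  induction, with no theory of two complex variables.\<close>

inductive sesqui :: "complex set \<Rightarrow> (complex \<Rightarrow> complex \<Rightarrow> complex) \<Rightarrow> bool" for D where
  hol: "a holomorphic_on D \<Longrightarrow> sesqui D (\<lambda>z w. a z)"
| antihol: "b holomorphic_on D \<Longrightarrow> sesqui D (\<lambda>z w. cnj (b w))"
| add: "sesqui D S \<Longrightarrow> sesqui D T \<Longrightarrow> sesqui D (\<lambda>z w. S z w + T z w)"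
| mult: "sesqui D S \<Longrightarrow> sesqui D T \<Longrightarrow> sesqui D (\<lambda>z w. S z w * T z w)"

lemma sesqui_const: "sesqui D (\<lambda>z w. c)"
  by (rule sesqui.hol) simp

lemma sesqui_diff:
  assumes "sesqui D S" "sesqui D T"
  shows "sesqui D (\<lambda>z w. S z w - T z w)"
  using sesqui.add[OF assms(1) sesqui.mult[OF sesqui_const[of D "-1"] assms(2)]] by simp

lemma sesqui_sum: "(\<And>i. i \<in> I \<Longrightarrow> sesqui D (T i)) \<Longrightarrow> sesqui D (\<lambda>z w. \<Sum>i\<in>I. T i z w)"
  by (induction I rule: infinite_finite_induct) (auto intro: sesqui_const sesqui.add)

lemma sesqui_power: "sesqui D T \<Longrightarrow> sesqui D (\<lambda>z w. T z w ^ n)"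
  by (induction n) (auto intro: sesqui_const sesqui.mult)

lemmas sesqui_intros = sesqui_const sesqui_diff sesqui_sum sesqui_power sesqui.intros

text \<open>The linear part of the differential of \<open>z \<mapsto> T z z\<close> is the partial
  derivative in the first argument, taken on the diagonal. That \<open>T1\<close> is again
  \<open>sesqui\<close> is what allows iteration; of \<open>T2\<close> only the existence
  matters.\<close>

lemma sesqui_derivative:
  assumes D: "open D" and "sesqui D T"
  shows "\<exists>T1 T2. sesqui D T1 \<and>
    (\<forall>z\<in>D. \<forall>w. ((\<lambda>z. T z w) has_field_derivative T1 z w) (at z)) \<and>
    (\<forall>z\<in>D. ((\<lambda>z. T z z) has_derivative (\<lambda>x. T1 z z * x + T2 z * cnj x)) (at z))"
  using assms(2)
proof induction
  case (hol a)
  then have d: "(a has_field_derivative deriv a z) (at z)" if "z \<in> D" for z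
    using D that by (simp add: holomorphic_derivI)
  show ?case
    by (rule exI[of _ "\<lambda>z w. deriv a z"], rule exI[of _ "\<lambda>z. 0"])
      (use d hol D in \<open>auto intro!: sesqui.hol holomorphic_deriv simp: has_field_derivative_def\<close>)
next
  case (antihol b)
  then have d: "(b has_derivative (\<lambda>x. deriv b z * x)) (at z)" if "z \<in> D" for z
    using D that holomorphic_derivI[of b D z UNIV] by (simp add: has_field_derivative_def)
  show ?case
    by (rule exI[of _ "\<lambda>z w. 0"], rule exI[of _ "\<lambda>z. cnj (deriv b z)"])
      (use d has_derivative_cnj[OF d] in \<open>auto intro!: sesqui_const\<close>)
next
  case (add S T)
  obtain S1 S2 where S: "sesqui D S1"
    "\<forall>z\<in>D. \<forall>w. ((\<lambda>z. S z w) has_field_derivative S1 z w) (at z)"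
    "\<forall>z\<in>D. ((\<lambda>z. S z z) has_derivative (\<lambda>x. S1 z z * x + S2 z * cnj x)) (at z)"
    using add.IH(1) by blast
  obtain T1 T2 where T: "sesqui D T1"
    "\<forall>z\<in>D. \<forall>w. ((\<lambda>z. T z w) has_field_derivative T1 z w) (at z)"
    "\<forall>z\<in>D. ((\<lambda>z. T z z) has_derivative (\<lambda>x. T1 z z * x + T2 z * cnj x)) (at z)"
    using add.IH(2) by blast
  show ?case
  proof (intro exI conjI ballI allI)
    show "sesqui D (\<lambda>z w. S1 z w + T1 z w)"
      using S(1) T(1) by (rule sesqui.add)
    fix z assume z: "z \<in> D"
    show "((\<lambda>z. S z w + T z w) has_field_derivative S1 z w + T1 z w) (at z)" for w
      using S(2) T(2) z by (intro DERIV_add) auto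
    show "((\<lambda>z. S z z + T z z) has_derivative
        (\<lambda>x. (S1 z z + T1 z z) * x + (S2 z + T2 z) * cnj x)) (at z)"
      by (rule has_derivative_eq_rhs[OF has_derivative_add[OF S(3)[rule_format, OF z] T(3)[rule_format, OF z]]])
        (simp add: fun_eq_iff algebra_simps)
  qed
next
  case (mult S T)
  obtain S1 S2 where S: "sesqui D S1"
    "\<forall>z\<in>D. \<forall>w. ((\<lambda>z. S z w) has_field_derivative S1 z w) (at z)"
    "\<forall>z\<in>D. ((\<lambda>z. S z z) has_derivative (\<lambda>x. S1 z z * x + S2 z * cnj x)) (at z)"
    using mult.IH(1) by blast
  obtain T1 T2 where T: "sesqui D T1"
    "\<forall>z\<in>D. \<forall>w. ((\<lambda>z. T z w) has_field_derivative T1 z w) (at z)"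
    "\<forall>z\<in>D. ((\<lambda>z. T z z) has_derivative (\<lambda>x. T1 z z * x + T2 z * cnj x)) (at z)"
    using mult.IH(2) by blast
  show ?case
  proof (intro exI conjI ballI allI)
    show "sesqui D (\<lambda>z w. S1 z w * T z w + S z w * T1 z w)"
      using S(1) T(1) mult.hyps by (intro sesqui.add sesqui.mult)
    fix z assume z: "z \<in> D"
    show "((\<lambda>z. S z w * T z w) has_field_derivative S1 z w * T z w + S z w * T1 z w) (at z)" for w
      using DERIV_mult[OF S(2)[rule_format, OF z, of w] T(2)[rule_format, OF z, of w]]
      by (simp add: ac_simps)
    show "((\<lambda>z. S z z * T z z) has_derivative (\<lambda>x. (S1 z z * T z z + S z z * T1 z z) * x
        + (S2 z * T z z + S z z * T2 z) * cnj x)) (at z)"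
      by (rule has_derivative_eq_rhs[OF has_derivative_mult[OF S(3)[rule_format, OF z] T(3)[rule_format, OF z]]])
        (simp add: fun_eq_iff algebra_simps)
  qed
qed

lemma sesqui_holomorphic: "open D \<Longrightarrow> sesqui D T \<Longrightarrow> (\<lambda>z. T z w) holomorphic_on D"
  by (metis sesqui_derivative holomorphic_on_open)

lemma linear_cnj_zero:
  fixes p q :: complex
  assumes "\<And>x. p * x + q * cnj x = 0"
  shows "p = 0"
proof -
  have "p + q = 0" "\<i> * (p - q) = 0"
    using assms[of 1] assms[of \<i>] by (simp_all add: algebra_simps)
  then show ?thesis
    by simp
qed

text \<open>If \<open>T\<close> vanishes on the diagonal, so does its \<open>z\<close>-derivative, because the differential of
  \<open>z \<mapsto> T z z\<close> splits into its complex linear and antilinear parts.\<close>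

lemma sesqui_higher_deriv_diagonal:
  assumes D: "open D" "w \<in> D"
  shows "sesqui D T \<Longrightarrow> (\<And>z. z \<in> D \<Longrightarrow> T z z = 0) \<Longrightarrow> (deriv ^^ n) (\<lambda>z. T z w) w = 0"
proof (induction n arbitrary: T)
  case 0
  then show ?case using D by simp
next
  case (Suc n)
  obtain T1 T2 where T1: "sesqui D T1"
    "\<forall>z\<in>D. \<forall>w. ((\<lambda>z. T z w) has_field_derivative T1 z w) (at z)"
    "\<forall>z\<in>D. ((\<lambda>z. T z z) has_derivative (\<lambda>x. T1 z z * x + T2 z * cnj x)) (at z)"
    using sesqui_derivative[OF D(1) Suc.prems(1)] by blast
  have "T1 z z = 0" if z: "z \<in> D" for z
  proof -
    have "((\<lambda>z. T z z) has_derivative (\<lambda>x. 0)) (at z)"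
      by (rule has_derivative_transform_within_open[OF has_derivative_const D(1) z])
        (simp add: Suc.prems(2))
    then have eq: "(\<lambda>x. T1 z z * x + T2 z * cnj x) = (\<lambda>x. 0)"
      using T1(3) z by (blast intro: has_derivative_unique)
    show ?thesis
      by (rule linear_cnj_zero[where q = "T2 z"]) (use eq in \<open>simp add: fun_eq_iff\<close>)
  qed
  then have "(deriv ^^ n) (\<lambda>z. T1 z w) w = 0"
    by (rule Suc.IH[OF T1(1)])
  moreover have "(deriv ^^ n) (deriv (\<lambda>z. T z w)) w = (deriv ^^ n) (\<lambda>z. T1 z w) w"
  proof (rule higher_deriv_cong_ev)
    show "\<forall>\<^sub>F x in nhds w. deriv (\<lambda>z. T z w) x = T1 x w"
      using D by (auto simp: eventually_nhds intro!: exI[of _ D] DERIV_imp_deriv T1(2)[rule_format])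
  qed simp
  ultimately show ?case
    by (simp add: funpow_Suc_right del: funpow.simps)
qed

text \<open>With \<open>w\<close> fixed, the Taylor series of \<open>z \<mapsto> T z w\<close> at
  the diagonal point \<open>z = w\<close> vanishes, so the identity theorem applies.\<close>

lemma sesqui_polarization:
  assumes "open D" "connected D" "sesqui D T" "\<And>z. z \<in> D \<Longrightarrow> T z z = 0" "z \<in> D" "w \<in> D"
  shows "T z w = 0"
  by (rule holomorphic_fun_eq_0_on_connected[OF sesqui_holomorphic[OF assms(1,3), of w] assms(1,2)
        sesqui_higher_deriv_diagonal[OF assms(1,6,3,4)] assms(6,5)])

section \<open>Polynomial potentials\<close>

text \<open>The class is closed under directional derivatives, which supplies the second derivatives
  that \<open>ddbar\<close> requires.\<close>

inductive poly_fun :: "(complex^'n \<Rightarrow> complex) \<Rightarrow> bool" where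
  const: "poly_fun (\<lambda>z. c)"
| coord: "poly_fun (\<lambda>z. z $ j)"
| add: "poly_fun F \<Longrightarrow> poly_fun G \<Longrightarrow> poly_fun (\<lambda>z. F z + G z)"
| mult: "poly_fun F \<Longrightarrow> poly_fun G \<Longrightarrow> poly_fun (\<lambda>z. F z * G z)"

lemma poly_fun_sum: "(\<And>i. i \<in> I \<Longrightarrow> poly_fun (F i)) \<Longrightarrow> poly_fun (\<lambda>z. \<Sum>i\<in>I. F i z)"
  by (induction I rule: infinite_finite_induct) (auto intro: poly_fun.intros)

lemma poly_fun_prod: "(\<And>i. i \<in> I \<Longrightarrow> poly_fun (F i)) \<Longrightarrow> poly_fun (\<lambda>z. \<Prod>i\<in>I. F i z)"
  by (induction I rule: infinite_finite_induct) (auto intro: poly_fun.intros)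

lemma poly_fun_power: "poly_fun F \<Longrightarrow> poly_fun (\<lambda>z. F z ^ k)"
  by (induction k) (auto intro: poly_fun.intros)

lemma homogeneous_poly_poly_fun:
  assumes "homogeneous_poly d G"
  shows "poly_fun G"
proof -
  obtain c where "G = (\<lambda>z. \<Sum>\<alpha> | (\<Sum>i\<in>UNIV. \<alpha> i) = d. c \<alpha> * (\<Prod>i\<in>UNIV. z $ i ^ \<alpha> i))"
    using assms by (auto simp: homogeneous_poly_def fun_eq_iff)
  then show ?thesis
    by (auto intro!: poly_fun_sum poly_fun_prod poly_fun_power poly_fun.intros)
qed

lemma homogeneous_poly_scale:
  assumes "homogeneous_poly d G"
  shows "G (t *s z) = t ^ d * G z"
proof -
  obtain c where c: "G z = (\<Sum>\<alpha> | (\<Sum>i\<in>UNIV. \<alpha> i) = d. c \<alpha> * (\<Prod>i\<in>UNIV. z $ i ^ \<alpha> i))" for z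
    using assms by (auto simp: homogeneous_poly_def)
  have "(\<Prod>i\<in>UNIV. (t *s z) $ i ^ \<alpha> i) = t ^ (\<Sum>i\<in>UNIV. \<alpha> i) * (\<Prod>i\<in>UNIV. z $ i ^ \<alpha> i)" for \<alpha> :: "'a \<Rightarrow> nat"
    by (simp add: power_mult_distrib prod.distrib power_sum)
  then show ?thesis
    unfolding c by (simp add: sum_distrib_left ac_simps)
qed

lemma bounded_linear_vec_smult: "bounded_linear (\<lambda>x. x *s (e :: complex^'n))"
  by (intro linear_conv_bounded_linear[THEN iffD1] linearI) (simp_all add: vec_eq_iff algebra_simps)

definition complex_differential :: "(complex^'n \<Rightarrow> complex) \<Rightarrow> (complex^'n \<Rightarrow> complex^'n \<Rightarrow> complex) \<Rightarrow> bool" where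
  "complex_differential F F' \<longleftrightarrow>
     (\<forall>z. (F has_derivative F' z) (at z)) \<and> (\<forall>z c v. F' z (c *s v) = c * F' z v)"

lemma poly_fun_differential:
  "poly_fun F \<Longrightarrow> \<exists>F'. complex_differential F F' \<and> (\<forall>v. poly_fun (\<lambda>z. F' z v))"
proof (induction rule: poly_fun.induct)
  case (const c)
  show ?case
    by (rule exI[of _ "\<lambda>z v. 0"]) (auto simp: complex_differential_def intro: poly_fun.intros)
next
  case (coord j)
  show ?case
    by (rule exI[of _ "\<lambda>z v. v $ j"])
      (auto simp: complex_differential_def
        intro!: poly_fun.intros bounded_linear_imp_has_derivative bounded_linear_vec_nth)
next
  case (add F G)
  obtain F' where F: "complex_differential F F'" "\<forall>v. poly_fun (\<lambda>z. F' z v)"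
    using add.IH(1) by blast
  obtain G' where G: "complex_differential G G'" "\<forall>v. poly_fun (\<lambda>z. G' z v)"
    using add.IH(2) by blast
  show ?case
    by (rule exI[of _ "\<lambda>z v. F' z v + G' z v"])
      (use F G in \<open>auto simp: complex_differential_def algebra_simps intro!: poly_fun.add has_derivative_add\<close>)
next
  case (mult F G)
  obtain F' where F: "complex_differential F F'" "\<forall>v. poly_fun (\<lambda>z. F' z v)"
    using mult.IH(1) by blast
  obtain G' where G: "complex_differential G G'" "\<forall>v. poly_fun (\<lambda>z. G' z v)"
    using mult.IH(2) by blast
  show ?case
  proof (intro exI conjI allI)
    show "complex_differential (\<lambda>z. F z * G z) (\<lambda>z v. F z * G' z v + F' z v * G z)"
      unfolding complex_differential_def
    proof (intro conjI allI)
      show "((\<lambda>z. F z * G z) has_derivative (\<lambda>v. F z * G' z v + F' z v * G z)) (at z)" for z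
        using F(1) G(1) by (intro has_derivative_mult) (auto simp: complex_differential_def)
      show "F z * G' z (c *s v) + F' z (c *s v) * G z = c * (F z * G' z v + F' z v * G z)" for z c v
        using F(1) G(1) by (simp add: complex_differential_def algebra_simps)
    qed
    show "poly_fun (\<lambda>z. F z * G' z v + F' z v * G z)" for v
      using F(2) G(2) mult.hyps by (intro poly_fun.add poly_fun.mult) auto
  qed
qed

text \<open>On the line through \<open>v\<close> the polynomial is \<open>t ^ d * G v\<close>, which
  has a multiple zero at 0. This is why only the coordinates contribute to the derivative of
  \<open>h\<close> at the origin.\<close>

lemma homogeneous_poly_differential_zero:
  assumes G: "homogeneous_poly d G" "2 \<le> d" and G': "complex_differential G G'"
  shows "G' 0 v = 0"
proof -
  have d: "(G has_derivative G' 0) (at (0 *s v))"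
    using G' by (simp add: complex_differential_def)
  have "((\<lambda>t. t *s v) has_derivative (\<lambda>t. t *s v)) (at 0)"
    by (rule bounded_linear_imp_has_derivative[OF bounded_linear_vec_smult])
  from has_derivative_compose[OF this, OF d]
  have "((\<lambda>t. t ^ d * G v) has_derivative (\<lambda>t. t * G' 0 v)) (at 0)"
    using G' by (simp add: homogeneous_poly_scale[OF G(1)] complex_differential_def)
  then have "((\<lambda>t. t ^ d * G v) has_field_derivative G' 0 v) (at 0)"
    by (simp add: has_field_derivative_def mult.commute[of _ "G' 0 v"])
  moreover have "((\<lambda>t. t ^ d * G v) has_field_derivative 0) (at 0)"
    using G(2) by (auto intro!: derivative_eq_intros)
  ultimately show ?thesis
    by (rule DERIV_unique)
qed

section \<open>The mixed derivative of the logarithm of a potential\<close>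

lemma wirt_split:
  assumes "(F has_derivative (\<lambda>x. a x + cnj (b x))) (at z)"
    and "\<And>c x. a (c *s x) = c * a x" "\<And>c x. b (c *s x) = c * b x"
  shows "wirt F z u = a u" "wirt_bar F z u = cnj (b u)"
proof -
  have "frechet_derivative F (at z) = (\<lambda>x. a x + cnj (b x))"
    using frechet_derivative_at[OF assms(1)] by simp
  then show "wirt F z u = a u" "wirt_bar F z u = cnj (b u)"
    by (simp_all add: wirt_def wirt_bar_def assms(2,3) algebra_simps)
qed

text \<open>This is the quotient rule: the mixed derivative of log h is h times the mixed derivative
  of h, minus the product of the two first derivatives, over h squared. The signs
  \<open>\<epsilon>\<close> let one formula serve both the ball and \<Omega>.\<close>

lemma ddbar_log:
  fixes A :: "'l \<Rightarrow> complex^'n \<Rightarrow> complex" and \<epsilon> :: "'l \<Rightarrow> real"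
  assumes A: "\<And>l. l \<in> I \<Longrightarrow> complex_differential (A l) (A' l)"
    and A': "\<And>l v. l \<in> I \<Longrightarrow> poly_fun (\<lambda>z. A' l z v)"
    and h: "\<And>z. h z z = 1 + (\<Sum>l\<in>I. of_real (\<epsilon> l) * A l z * cnj (A l z))"
    and S: "open S" "\<And>z. z \<in> S \<Longrightarrow> Re (h z z) > 0" and z: "z \<in> S"
  shows "ddbar (\<lambda>w. ln (Re (h w w))) z u v =
    (h z z * (\<Sum>l\<in>I. of_real (\<epsilon> l) * A' l z u * cnj (A' l z v))
      - (\<Sum>l\<in>I. of_real (\<epsilon> l) * A l z * cnj (A' l z v)) * (\<Sum>l\<in>I. of_real (\<epsilon> l) * A' l z u * cnj (A l z))) / (h z z)\<^sup>2"
proof -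
  define N where "N = (\<lambda>w v. \<Sum>l\<in>I. of_real (\<epsilon> l) * A l w * cnj (A' l w v))"
  have A1: "(A l has_derivative A' l w) (at w)" "A' l w (c *s x) = c * A' l w x" if "l \<in> I" for l w c x
    using A[OF that] by (auto simp: complex_differential_def)
  \<comment> \<open>Since \<open>h w w\<close> is real, division by it commutes with conjugation,
    which splits the differential of the logarithm into its linear and antilinear parts.\<close>
  have real_h: "h w w = of_real (Re (h w w))" for w
  proof (rule complex_eqI)
    show "Im (h w w) = Im (of_real (Re (h w w)))"
      by (simp add: h mult.assoc flip: complex_norm_square)
  qed simp
  have dh: "((\<lambda>w. h w w) has_derivative (\<lambda>x. cnj (N w x) + N w x)) (at w)" for w
    unfolding h N_def
    by (rule derivative_eq_intros A1 refl | assumption)+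
      (simp add: fun_eq_iff sum.distrib algebra_simps)
  have wb: "wirt_bar (\<lambda>w. complex_of_real (ln (Re (h w w)))) w v = N w v / h w w" if w: "w \<in> S" for w v
  proof -
    have "((\<lambda>w. complex_of_real (ln (Re (h w w)))) has_derivative
        (\<lambda>x. of_real (Re (cnj (N w x) + N w x) / Re (h w w)))) (at w)"
      by (rule derivative_eq_intros dh refl S w)+
        (simp add: divide_inverse mult.commute)
    moreover have "(\<lambda>x. complex_of_real (Re (cnj (N w x) + N w x) / Re (h w w)))
        = (\<lambda>x. cnj (N w x / h w w) + cnj (cnj (N w x / h w w)))"
      by (subst (2 3) real_h) (auto simp: fun_eq_iff complex_eq_iff field_simps)
    ultimately have "((\<lambda>w. complex_of_real (ln (Re (h w w)))) has_derivative
        (\<lambda>x. cnj (N w x / h w w) + cnj (cnj (N w x / h w w)))) (at w)"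
      by simp
    then have "wirt_bar (\<lambda>w. complex_of_real (ln (Re (h w w)))) w v = cnj (cnj (N w v / h w w))"
      by (rule wirt_split) (subst (1 2) real_h, simp add: N_def A1 sum_distrib_left mult.assoc mult.left_commute)+
    then show ?thesis by simp
  qed
  have "\<exists>B. complex_differential (\<lambda>w. A' l w v) B" if "l \<in> I" for l
    using poly_fun_differential[OF A'[OF that]] by blast
  then obtain B where "\<And>l. l \<in> I \<Longrightarrow> complex_differential (\<lambda>w. A' l w v) (B l)"
    by metis
  then have B: "((\<lambda>w. A' l w v) has_derivative B l w) (at w)" "B l w (c *s x) = c * B l w x"
    if "l \<in> I" for l w c x
    using that by (auto simp: complex_differential_def)
  \<comment> \<open>\<open>M\<close> and \<open>P\<close> are the linear and antilinear parts of the
    differential of \<open>N\<close>. The second derivatives \<open>B\<close> enter only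
    \<open>P\<close>, which \<open>wirt\<close> discards.\<close>
  define M where "M = (\<lambda>x. \<Sum>l\<in>I. of_real (\<epsilon> l) * A' l z x * cnj (A' l z v))"
  define P where "P = (\<lambda>x. \<Sum>l\<in>I. of_real (\<epsilon> l) * A l z * cnj (B l z x))"
  define a where "a = (\<lambda>x. (h z z * M x - N z v * cnj (N z x)) / (h z z)\<^sup>2)"
  define b where "b = (\<lambda>x. cnj ((h z z * P x - N z v * N z x) / (h z z)\<^sup>2))"
  have lin: "N z (c *s x) = cnj c * N z x" "M (c *s x) = c * M x" "P (c *s x) = cnj c * P x" for c x
    unfolding N_def M_def P_def by (simp_all add: A1 B sum_distrib_left ac_simps)
  have h0: "h z z \<noteq> 0"
    using S(2)[OF z] by auto
  have dN: "((\<lambda>w. N w v) has_derivative (\<lambda>x. M x + P x)) (at z)"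
    unfolding N_def M_def P_def
    by (rule derivative_eq_intros A1 B refl | assumption)+
      (simp add: fun_eq_iff sum.distrib algebra_simps)
  have "((\<lambda>w. N w v / h w w) has_derivative (\<lambda>x. a x + cnj (b x))) (at z)"
    by (rule has_derivative_eq_rhs[OF has_derivative_divide'[OF dN dh h0]])
      (simp add: a_def b_def fun_eq_iff power2_eq_square add_divide_distrib[symmetric] algebra_simps)
  then have "((\<lambda>w. wirt_bar (\<lambda>x. complex_of_real (ln (Re (h x x)))) w v)
      has_derivative (\<lambda>x. a x + cnj (b x))) (at z)"
    by (rule has_derivative_transform_within_open[OF _ S(1) z]) (simp add: wb)
  then have "wirt (\<lambda>w. wirt_bar (\<lambda>x. complex_of_real (ln (Re (h x x)))) w v) z u = a u"
    by (rule wirt_split(1)) (simp_all add: a_def b_def lin algebra_simps)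
  moreover have "cnj (N z u) = (\<Sum>l\<in>I. of_real (\<epsilon> l) * A' l z u * cnj (A l z))"
    by (simp add: N_def ac_simps)
  ultimately show ?thesis
    by (simp add: ddbar_def a_def M_def N_def)
qed

section \<open>Integrating the curvature identity on the unit disc\<close>

lemma one_minus_mult_cnj_nonzero:
  fixes z w :: complex
  assumes "z \<in> ball 0 1" "w \<in> ball 0 1"
  shows "1 - z * cnj w \<noteq> 0"
proof
  assume "1 - z * cnj w = 0"
  then have "norm z * norm w = 1"
    by (metis complex_mod_cnj eq_iff_diff_eq_0 norm_mult norm_one)
  moreover have "norm z * norm w < 1 * 1"
    using assms by (intro mult_strict_mono') auto
  ultimately show False by simp
qed

text \<open>\<open>N\<close>, \<open>N'\<close> and \<open>M\<close> are the derivatives of \<open>H\<close> in \<open>cnj w\<close>, in \<open>z\<close> and in both, so \<open>curv\<close> says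
  that \<open>log H\<close> and \<open>k log (1 - z cnj w)\<close> have the same mixed derivative on the diagonal. It
  polarizes and is then integrated twice: in \<open>z\<close> starting at \<open>0\<close>, giving the fact \<open>X\<close>, and in \<open>w\<close>
  starting at \<open>0\<close>.\<close>

lemma disc_potential:
  fixes a :: "'l \<Rightarrow> complex \<Rightarrow> complex" and \<epsilon> :: "'l \<Rightarrow> real"
  assumes a: "\<And>l. l \<in> I \<Longrightarrow> a l holomorphic_on ball 0 1" "\<And>l. l \<in> I \<Longrightarrow> a l 0 = 0"
  defines "H \<equiv> \<lambda>z w. 1 + (\<Sum>l\<in>I. of_real (\<epsilon> l) * a l z * cnj (a l w))"
  defines "M \<equiv> \<lambda>z w. \<Sum>l\<in>I. of_real (\<epsilon> l) * deriv (a l) z * cnj (deriv (a l) w)"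
  defines "N \<equiv> \<lambda>z w. \<Sum>l\<in>I. of_real (\<epsilon> l) * a l z * cnj (deriv (a l) w)"
  defines "N' \<equiv> \<lambda>z w. \<Sum>l\<in>I. of_real (\<epsilon> l) * deriv (a l) z * cnj (a l w)"
  assumes k: "1 \<le> k"
    and curv: "\<And>z. z \<in> ball 0 1 \<Longrightarrow>
      (H z z * M z z - N z z * N' z z) * (1 - z * cnj z)\<^sup>2 = - of_nat k * (H z z)\<^sup>2"
    and z: "z \<in> ball 0 1" and w: "w \<in> ball 0 1"
  shows "H z w = (1 - z * cnj w) ^ k"
proof -
  let ?D = "ball (0::complex) 1"
  have a': "(a l has_field_derivative deriv (a l) z) (at z)" if "l \<in> I" "z \<in> ?D" for l z
    using a(1)[OF that(1)] that(2) by (simp add: holomorphic_derivI)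
  have hol': "deriv (a l) holomorphic_on ?D" if "l \<in> I" for l
    using a(1)[OF that] by (simp add: holomorphic_deriv)
  have sesq: "sesqui ?D H" "sesqui ?D M" "sesqui ?D N" "sesqui ?D N'"
    unfolding H_def M_def N_def N'_def
    by (intro sesqui_intros hol' a; assumption)+
  \<comment> \<open>Without denominators the identity is polynomial in \<open>sesqui\<close>
    functions, so polarization applies wherever \<open>H\<close> may vanish.\<close>
  have "sesqui ?D (\<lambda>z w. (H z w * M z w - N z w * N' z w) * (1 - z * cnj w)\<^sup>2 - - of_nat k * (H z w)\<^sup>2)"
    by (intro sesqui_intros sesq holomorphic_intros)
  note pol = sesqui_polarization[OF open_ball connected_ball this]
  have eq: "(H z w * M z w - N z w * N' z w) * (1 - z * cnj w)\<^sup>2 = - of_nat k * (H z w)\<^sup>2"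
    if "z \<in> ?D" "w \<in> ?D" for z w
    using pol[OF _ that] curv by (simp add: add_eq_0_iff2)
  have dH: "((\<lambda>z. H z w) has_field_derivative N' z w) (at z)" if "z \<in> ?D" for z w
    unfolding H_def N'_def
    by (rule derivative_eq_intros a' that refl | assumption)+ (simp add: algebra_simps)
  have dN: "((\<lambda>z. N z w) has_field_derivative M z w) (at z)" if "z \<in> ?D" for z w
    unfolding N_def M_def
    by (rule derivative_eq_intros a' that refl | assumption)+ (simp add: algebra_simps)
  have dH': "((\<lambda>w. cnj (H z w)) has_field_derivative cnj (N z w)) (at w)" if "w \<in> ?D" for z w
    unfolding H_def N_def complex_cnj_add cnj_sum complex_cnj_mult complex_cnj_cnj
      complex_cnj_complex_of_real complex_cnj_one
    by (rule derivative_eq_intros a' that refl | assumption)+ (simp add: algebra_simps)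
  have H0: "H 0 w = 1" "N 0 w = 0" "H z 0 = 1" for z w
    by (simp_all add: H_def N_def a(2))
  \<comment> \<open>This says that log H and k log (1 - z cnj w) have the same derivative in
    \<open>cnj w\<close>, again without denominators.\<close>
  have X: "N z w * (1 - z * cnj w) + of_nat k * z * H z w = 0" if z: "z \<in> ?D" and w: "w \<in> ?D" for z w
  proof -
    let ?X = "\<lambda>z. N z w * (1 - z * cnj w) + of_nat k * z * H z w"
    \<comment> \<open>\<open>H 0 w = 1\<close> gives a disc around 0, depending on \<open>w\<close>,
      on which dividing by \<open>H\<close> is legitimate.\<close>
    have "isCont (\<lambda>z. H z w) 0"
      by (rule DERIV_isCont[OF dH]) simp
    then obtain r where r: "r > 0" "\<And>z. dist 0 z < r \<Longrightarrow> H z w \<noteq> 0"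
      using continuous_at_avoid[of 0 "\<lambda>z. H z w" 0] H0(1) by auto
    define B where "B = ball (0::complex) (min r 1)"
    have B: "z \<in> ?D" "H z w \<noteq> 0" "1 - z * cnj w \<noteq> 0" if "z \<in> B" for z
      using that r(2)[of z] one_minus_mult_cnj_nonzero[of z w] w by (auto simp: B_def)
    have "((\<lambda>z. N z w / H z w + of_nat k * z / (1 - z * cnj w)) has_field_derivative 0) (at z)"
      if "z \<in> B" for z
    proof -
      have "((\<lambda>z. N z w / H z w + of_nat k * z / (1 - z * cnj w)) has_field_derivative
          (H z w * M z w - N z w * N' z w) / (H z w)\<^sup>2 + of_nat k / (1 - z * cnj w)\<^sup>2) (at z)"
        by (rule derivative_eq_intros dN dH B[OF that] refl)+
          (use B[OF that] in \<open>simp add: power2_eq_square algebra_simps\<close>)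
      moreover have "(H z w * M z w - N z w * N' z w) / (H z w)\<^sup>2 + of_nat k / (1 - z * cnj w)\<^sup>2 = 0"
        using eq[OF B(1)[OF that] w] B[OF that] by (simp add: divide_simps)
      ultimately show ?thesis by simp
    qed
    then have "(\<lambda>z. N z w / H z w + of_nat k * z / (1 - z * cnj w)) constant_on B"
      unfolding B_def by (intro has_field_derivative_0_imp_constant_on) auto
    moreover have "0 \<in> B" using r by (simp add: B_def)
    ultimately have "N z w / H z w + of_nat k * z / (1 - z * cnj w) = 0" if "z \<in> B" for z
      using that H0 unfolding constant_on_def by (metis add.right_neutral div_0 mult_zero_right)
    \<comment> \<open>Multiplying the denominators back in turns the equation of quotients into one
      between functions holomorphic on the whole disc, ready for continuation from
      \<open>B\<close>.\<close>
    moreover have "n * u + m * h = (n / h + m / u) * (h * u)" if "h \<noteq> 0" "u \<noteq> 0" for n h u m :: complex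
      using that by (simp add: field_simps)
    ultimately have XB: "?X z = 0" if "z \<in> B" for z
      using B[OF that] that by simp
    have "?X holomorphic_on ?D"
      by (intro holomorphic_intros sesqui_holomorphic[OF _ sesq(1)] sesqui_holomorphic[OF _ sesq(3)]) auto
    moreover have "B \<noteq> {}" "B \<subseteq> ?D"
      using \<open>0 \<in> B\<close> B(1) by auto
    ultimately show ?thesis
      using analytic_continuation_open[of B ?D ?X "\<lambda>_. 0", OF _ open_ball _ connected_ball _ _ _ XB z]
      by (simp add: B_def)
  qed
  \<comment> \<open>Conjugation makes the dependence on \<open>w\<close> holomorphic. The quotient
    by the expected answer replaces the difference of logarithms, and its denominator has no zeros
    on the disc.\<close>
  have "((\<lambda>w. cnj (H z w) / (1 - w * cnj z) ^ k) has_field_derivative 0) (at w)" if "w \<in> ?D" for w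
  proof -
    have nz: "1 - w * cnj z \<noteq> 0"
      by (rule one_minus_mult_cnj_nonzero[OF that z])
    obtain j where j: "k = Suc j" using k by (cases k) auto
    have "cnj (N z w * (1 - z * cnj w) + of_nat k * z * H z w) = 0"
      using X[OF z that] by simp
    then have x: "cnj (N z w) * (1 - w * cnj z) = - (of_nat k * cnj z * cnj (H z w))"
      by (simp add: add_eq_0_iff mult.commute)
    have "((\<lambda>w. cnj (H z w) / (1 - w * cnj z) ^ k) has_field_derivative
        (cnj (N z w) * (1 - w * cnj z) + of_nat k * cnj z * cnj (H z w)) / (1 - w * cnj z) ^ Suc k) (at w)"
      by (rule derivative_eq_intros dH' that refl)+
        (use nz in \<open>simp_all add: j divide_simps\<close>, simp add: algebra_simps)
    then show ?thesis using x by simp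
  qed
  then have "(\<lambda>w. cnj (H z w) / (1 - w * cnj z) ^ k) constant_on ?D"
    by (intro has_field_derivative_0_imp_constant_on) auto
  then have "cnj (H z w) / (1 - w * cnj z) ^ k = 1"
    using w H0(3) unfolding constant_on_def
    by (metis centre_in_ball complex_cnj_one diff_zero div_by_1 mult_zero_left power_one zero_less_one)
  then have "cnj (H z w) = (1 - w * cnj z) ^ k"
    using one_minus_mult_cnj_nonzero[OF w z] by (simp add: divide_eq_eq split: if_splits)
  then have "cnj (cnj (H z w)) = cnj ((1 - w * cnj z) ^ k)" by simp
  then show ?thesis by (simp add: mult.commute)
qed

section \<open>Linear algebra\<close>

text \<open>Choose coordinates in which a basis of \<open>V\<close> becomes part of the standard
  basis. The remaining coordinate functionals are rows of the invertible matrix \<open>P\<close> and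
  cut out exactly \<open>V\<close>.\<close>

lemma rows_ker_exists:
  fixes V :: "(complex^'n) set"
  assumes V: "vec.subspace V"
  shows "\<exists>A. full_rank_rows (CARD('n) - vec.dim V) A \<and> V = rows_ker A"
proof -
  obtain B where B: "B \<subseteq> V" "vec.independent B" "V \<subseteq> vec.span B" "card B = vec.dim V"
    by (rule vec.basis_exists)
  have spanB: "vec.span B = V"
    using B V by (metis vec.span_minimal subset_antisym)
  define B' where "B' = vec.extend_basis B"
  have B': "B \<subseteq> B'" "vec.independent B'" "vec.span B' = UNIV"
    using B(2) by (simp_all add: B'_def vec.extend_basis_superset vec.independent_extend_basis)
  have fin: "finite B'" "finite B"
    using B' B(2) by (simp_all add: vec.finiteI_independent)
  have "card B' = CARD('n)"
    using vec.dim_span_eq_card_independent[OF B'(2)] B'(3) vec_dim_card[where 'a = complex and 'n = 'n]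
    by simp
  then obtain \<sigma> where \<sigma>: "bij_betw \<sigma> B' (UNIV :: 'n set)"
    using fin(1) finite_same_card_bij[of B' "UNIV :: 'n set"] by auto
  obtain p where p: "Vector_Spaces.linear (*s) (*s) p" "\<And>b. b \<in> B' \<Longrightarrow> p b = axis (\<sigma> b) 1"
    using vec.linear_independent_extend[OF B'(2), of "\<lambda>b. axis (\<sigma> b) 1"] by auto
  define P :: "complex^'n^'n" where "P = matrix p"
  have P: "P *v x = p x" for x
    using p(1) by (simp add: P_def matrix_works)
  interpret p: Vector_Spaces.linear "(*s)" "(*s)" p by (rule p(1))
  have surj: "surj ((*v) P)"
  proof (rule surjI)
    fix y :: "complex^'n"
    have "p (\<Sum>b\<in>B'. y $ \<sigma> b *s b) = (\<Sum>b\<in>B'. y $ \<sigma> b *s axis (\<sigma> b) 1)"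
      by (simp add: p.sum p.scale p(2))
    also have "\<dots> = (\<Sum>i\<in>UNIV. y $ i *s axis i 1)"
      by (rule sum.reindex_bij_betw[OF \<sigma>])
    finally show "P *v (\<Sum>b\<in>B'. y $ \<sigma> b *s b) = y"
      by (simp add: P basis_expansion)
  qed
  then obtain Q where Q: "P ** Q = mat 1"
    using matrix_right_invertible_surjective by blast
  then have "Q ** P = mat 1"
    using matrix_left_right_inverse by blast
  then have inj: "inj ((*v) P)"
    using matrix_left_invertible_injective by blast
  have injt: "inj ((*v) (transpose P))"
    using Q by (metis matrix_left_invertible_injective matrix_transpose_mul transpose_mat)
  define K where "K = - \<sigma> ` B"
  have "card (\<sigma> ` B) = vec.dim V"
    using B(4) \<sigma> B'(1) by (metis bij_betw_def card_image inj_on_subset)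
  then have cardK: "card K = CARD('n) - vec.dim V"
    by (simp add: K_def Compl_eq_Diff_UNIV card_Diff_subset)
  obtain ks where ks: "set ks = K" "length ks = card K"
    using finite_distinct_list[of K] distinct_card by (metis finite_code)
  define A where "A = map (\<lambda>i. row i P) ks"
  \<comment> \<open>The transpose of \<open>P\<close> is injective, so independence of the chosen
    rows reduces to that of standard basis vectors.\<close>
  have row_eq: "row i P = transpose P *v axis i 1" for i
    by (simp add: vec_eq_iff row_def vector_matrix_mult_def axis_def if_distrib if_distribR cong: if_cong)
  have "vec.dim (set A) = card K"
  proof -
    have eq: "set A = (*v) (transpose P) ` (\<lambda>i. axis i 1) ` K"
      by (auto simp: A_def ks row_eq)
    have ind: "vec.independent ((\<lambda>i. axis i 1) ` K :: (complex^'n) set)"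
      by (rule vec.independent_mono[OF independent_cart_basis]) (auto simp: cart_basis_def)
    have "vec.dim (set A) = vec.dim ((\<lambda>i. axis i 1) ` K :: (complex^'n) set)"
      unfolding eq
      by (rule vec.dim_image_eq[OF matrix_vector_mul_linear_gen inj_on_subset[OF injt]]) simp
    also have "\<dots> = card ((\<lambda>i. axis i 1) ` K :: (complex^'n) set)"
      using ind by (rule vec.dim_eq_card_independent)
    also have "\<dots> = card K"
      by (intro card_image inj_onI) (simp add: axis_eq_axis)
    finally show ?thesis .
  qed
  then have "full_rank_rows (CARD('n) - vec.dim V) A"
    by (simp add: full_rank_rows_def cardK A_def ks)
  moreover have "V = rows_ker A"
  proof -
    have rk: "x \<in> rows_ker A \<longleftrightarrow> (\<forall>i\<in>K. p x $ i = 0)" for x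
      by (simp add: rows_ker_def A_def ks P[symmetric] matrix_vector_mult_def row_def)
    have "V \<subseteq> rows_ker A"
      unfolding spanB[symmetric]
    proof (rule vec.span_minimal)
      show "B \<subseteq> rows_ker A"
        using B'(1) by (auto simp: rk p(2) K_def axis_def subset_iff)
      show "vec.subspace (rows_ker A)"
        by (auto simp: vec.subspace_def rk p.add p.scale p.zero)
    qed
    moreover have "x \<in> V" if "x \<in> rows_ker A" for x
    proof -
      have inj\<sigma>: "inj_on \<sigma> B"
        using \<sigma> B'(1) by (meson bij_betw_def inj_on_subset)
      have "p x = (\<Sum>i\<in>UNIV. p x $ i *s axis i 1)"
        by (simp add: basis_expansion)
      also have "\<dots> = (\<Sum>i\<in>\<sigma> ` B. p x $ i *s axis i 1)"
        by (rule sum.mono_neutral_right) (use that in \<open>auto simp: rk K_def\<close>)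
      also have "\<dots> = (\<Sum>b\<in>B. p x $ \<sigma> b *s axis (\<sigma> b) 1)"
        by (simp add: sum.reindex[OF inj\<sigma>])
      also have "\<dots> = p (\<Sum>b\<in>B. p x $ \<sigma> b *s b)"
        using B'(1) by (simp add: p.sum p.scale p(2) subset_iff)
      finally have "x = (\<Sum>b\<in>B. p x $ \<sigma> b *s b)"
        using inj by (simp add: P inj_def)
      also have "\<dots> \<in> vec.span B"
        by (intro vec.span_sum vec.span_scale vec.span_base)
      finally show ?thesis
        unfolding spanB .
    qed
    ultimately show ?thesis by blast
  qed
  ultimately show ?thesis by blast
qed

text \<open>The right-hand side sees \<open>A\<close> only through its kernel; hence
  \<open>f_sharp\<close> does not depend on the matrix chosen for \<open>V\<close>.\<close>

lemma rows_ker_rows_mult: "rows_ker (rows_mult A B) = {w. B *v w \<in> rows_ker A}"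
proof -
  have "(\<Sum>j\<in>UNIV. (a v* B) $ j * w $ j) = (\<Sum>i\<in>UNIV. a $ i * (B *v w) $ i)" for a w
  proof -
    have "(\<Sum>j\<in>UNIV. (a v* B) $ j * w $ j) = (\<Sum>j\<in>UNIV. \<Sum>i\<in>UNIV. a $ i * (B $ i $ j * w $ j))"
      by (simp add: vector_matrix_mult_def sum_distrib_left sum_distrib_right ac_simps)
    also have "\<dots> = (\<Sum>i\<in>UNIV. \<Sum>j\<in>UNIV. a $ i * (B $ i $ j * w $ j))"
      by (rule sum.swap)
    finally show ?thesis
      by (simp add: matrix_vector_mult_def sum_distrib_left)
  qed
  then show ?thesis
    by (simp add: rows_ker_def rows_mult_def)
qed

section \<open>Matrices whose adjoint inverts them up to a scalar\<close>

locale scaled_isometry =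
  fixes J :: "complex^'n^'N" and c :: complex
  assumes c: "c \<noteq> 0" and JJ: "ctranspose J *v (J *v x) = c *s x"
begin

text \<open>For \<open>J = cjacobian f 0\<close> this is the value of \<open>f_sharp\<close> at
  \<open>V\<close>, free of any choice of equations for \<open>V\<close>.\<close>

definition lift :: "(complex^'n) set \<Rightarrow> (complex^'N) set" where
  "lift V = {w. ctranspose J *v w \<in> V}"

lemma inj_J: "inj ((*v) J)"
proof (rule injI)
  fix x y assume "J *v x = J *v y"
  then have "c *s x = c *s y"
    by (metis JJ)
  then show "x = y"
    using c by (simp add: vector_mul_lcancel)
qed

text \<open>The adjoint of \<open>J\<close> sends \<open>J *v x\<close> to \<open>c *s x\<close>,
  and \<open>c\<close> is invertible. Thus \<open>V\<close> can be recovered from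
  \<open>lift V\<close>, which yields injectivity of \<open>f_sharp\<close>.\<close>

lemma mem_lift: "J *v x \<in> lift V \<longleftrightarrow> x \<in> V" if "vec.subspace V"
  using that c vec.subspace_scale[of V x c] vec.subspace_scale[of V "c *s x" "inverse c"]
  by (auto simp: lift_def JJ)

lemma subspace_lift: "vec.subspace V \<Longrightarrow> vec.subspace (lift V)"
  using vec.subspace_vimage[of V "ctranspose J"] by (simp add: lift_def vimage_def)

lemma lift_eq_sum:
  assumes "vec.subspace V"
  shows "lift V = {a + b | a b. a \<in> (*v) J ` V \<and> b \<in> mat_ker (ctranspose J)}"
proof safe
  fix w assume w: "w \<in> lift V"
  \<comment> \<open>\<open>J *v a\<close> is the projection of \<open>w\<close> to the range of
    \<open>J\<close> along the kernel of the adjoint; the factor \<open>inverse c\<close> makes this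
    map idempotent.\<close>
  define a where "a = inverse c *s (ctranspose J *v w)"
  have "a \<in> V"
    using w assms by (simp add: lift_def a_def vec.subspace_scale)
  moreover have "w - J *v a \<in> mat_ker (ctranspose J)"
    using c by (simp add: mat_ker_def vec.diff JJ) (simp add: a_def)
  ultimately show "\<exists>a b. w = a + b \<and> a \<in> (*v) J ` V \<and> b \<in> mat_ker (ctranspose J)"
    by (intro exI[of _ "J *v a"] exI[of _ "w - J *v a"]) auto
next
  fix x b assume "x \<in> V" "b \<in> mat_ker (ctranspose J)"
  then show "J *v x + b \<in> lift V"
    using assms by (simp add: lift_def mat_ker_def vec.add JJ vec.subspace_scale)
qed

lemma image_Int_ker:
  assumes "vec.subspace V"
  shows "(*v) J ` V \<inter> mat_ker (ctranspose J) = {0}"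
proof -
  have "J *v x = 0" if "ctranspose J *v (J *v x) = 0" for x
    using that c by (simp add: JJ)
  moreover have "0 \<in> V" using assms by (rule vec.subspace_0)
  ultimately show ?thesis
    by (auto simp: mat_ker_def intro!: image_eqI[of _ _ 0])
qed

lemma dim_lift:
  assumes V: "vec.subspace V"
  shows "vec.dim (lift V) + CARD('n) = CARD('N) + vec.dim V"
proof -
  have ker: "vec.subspace (mat_ker (ctranspose J))"
    using vec.subspace_vimage[OF vec.subspace_single_0, of "ctranspose J"]
    by (simp add: mat_ker_def vimage_def)
  have *: "vec.dim (lift V) = vec.dim V + vec.dim (mat_ker (ctranspose J))" if "vec.subspace V" for V
  proof -
    have "vec.dim ((*v) J ` V) = vec.dim V"
      by (rule vec.dim_image_eq[OF matrix_vector_mul_linear_gen inj_on_subset[OF inj_J]]) simp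
    then show ?thesis
      using vec.dim_sums_Int[OF vec.subspace_image[OF that, of J] ker]
      by (simp add: lift_eq_sum[OF that] image_Int_ker[OF that] vec.dim_singleton)
  qed
  \<comment> \<open>Taking \<open>V = UNIV\<close> in the dimension formula computes the dimension
    of the kernel.\<close>
  have "lift UNIV = UNIV" by (simp add: lift_def)
  then have "CARD('N) = CARD('n) + vec.dim (mat_ker (ctranspose J))"
    using *[OF vec.subspace_UNIV] by (simp only: vec_dim_card)
  then show ?thesis using *[OF V] by simp
qed

text \<open>This guarantees that the natural number subtraction in
  \<open>CARD('N) - CARD('n) + m\<close> does not truncate.\<close>

lemma card_le: "CARD('n) \<le> CARD('N)"
  using dim_lift[OF vec.subspace_single_0] dim_lift[OF vec.subspace_UNIV] 
  by (simp add: vec.dim_singleton)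

end

section \<open>Holomorphic curves\<close>

lemma has_derivative_curve:
  fixes \<gamma> :: "complex \<Rightarrow> complex^'m"
  assumes "\<And>i. ((\<lambda>t. \<gamma> t $ i) has_field_derivative d $ i) (at t)"
  shows "(\<gamma> has_derivative (\<lambda>x. x *s d)) (at t)"
proof -
  have "((\<lambda>t. \<Sum>i\<in>UNIV. \<gamma> t $ i *s axis i 1) has_derivative (\<lambda>x. \<Sum>i\<in>UNIV. (d $ i * x) *s axis i 1)) (at t)"
    using assms
    by (intro has_derivative_sum bounded_linear.has_derivative[OF bounded_linear_vec_smult])
      (simp add: has_field_derivative_def)
  moreover have "(\<lambda>x. \<Sum>i\<in>UNIV. (d $ i * x) *s axis i 1) = (\<lambda>x. x *s d)"
  proof
    show "(\<Sum>i\<in>UNIV. (d $ i * x) *s axis i 1) = x *s d" for x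
      using basis_expansion[of "x *s d"] by (simp add: mult.commute)
  qed
  ultimately show ?thesis
    by (simp add: basis_expansion)
qed

lemma complex_differential_curve:
  assumes "complex_differential A A'" "(\<gamma> has_derivative (\<lambda>x. x *s d)) (at t)"
  shows "((\<lambda>t. A (\<gamma> t)) has_field_derivative A' (\<gamma> t) d) (at t)"
proof -
  have "(A has_derivative A' (\<gamma> t)) (at (\<gamma> t))" "A' (\<gamma> t) (x *s d) = A' (\<gamma> t) d * x" for x
    using assms(1) by (auto simp: complex_differential_def)
  then show ?thesis
    using has_derivative_compose[OF assms(2), of A "A' (\<gamma> t)"] by (simp add: has_field_derivative_def)
qed

lemma has_derivative_line:
  fixes c e :: "complex^'n"
  shows "((\<lambda>t. c + t *s e) has_derivative (\<lambda>x. x *s e)) (at t)"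
  using has_derivative_add[OF has_derivative_const
      bounded_linear_imp_has_derivative[OF bounded_linear_vec_smult]] by simp

text \<open>This links the two notions of derivative in use: \<open>cjacobian\<close> consists of
  one-variable derivatives, whereas \<open>holo_fun\<close> provides a total differential that is
  complex linear.\<close>

lemma holo_map_has_derivative_line:
  assumes f: "holo_map S f" and S: "c + t *s e \<in> S"
  shows "((\<lambda>t. f (c + t *s e)) has_derivative (\<lambda>x. x *s (cjacobian f (c + t *s e) *v e))) (at t)"
proof (rule has_derivative_curve)
  fix i
  let ?z = "c + t *s e"
  obtain D where D: "((\<lambda>z. f z $ i) has_derivative D) (at ?z)" "\<And>c v. D (c *s v) = c * D v"
    using f S unfolding holo_map_def holo_fun_def by meson
  have line: "((\<lambda>t. f (c + t *s e) $ i) has_field_derivative D e) (at t)"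
    if "((\<lambda>z. f z $ i) has_derivative D) (at (c + t *s e))" for c t e
    using has_derivative_compose[OF has_derivative_line that]
    by (simp add: has_field_derivative_def D(2) mult.commute[of _ "D e"])
  have "cpartial j (\<lambda>w. f w $ i) ?z = D (axis j 1)" for j
    unfolding cpartial_def by (rule DERIV_imp_deriv[OF line]) (simp add: D(1))
  then have "(cjacobian f ?z *v e) $ i = (\<Sum>j\<in>UNIV. D (axis j 1) * e $ j)"
    by (simp add: cjacobian_def matrix_vector_mult_def)
  also have "\<dots> = (\<Sum>j\<in>UNIV. D (e $ j *s axis j 1))"
    by (simp add: D(2) mult.commute)
  also have "\<dots> = D (\<Sum>j\<in>UNIV. e $ j *s axis j 1)"
    by (rule linear_sum[OF has_derivative_linear[OF D(1)], symmetric])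
  also have "\<dots> = D e"
    by (simp add: basis_expansion)
  finally show "((\<lambda>t. f (c + t *s e) $ i) has_field_derivative (cjacobian f ?z *v e) $ i) (at t)"
    using line[OF D(1)] by simp
qed

section \<open>The ball metric along a complex line through the origin\<close>

lemma norm_vector_smult: "norm (x *s y) = norm x * norm (y :: complex^'n)"
  by (simp add: norm_vec_def norm_mult L2_set_right_distrib[symmetric])

lemma sum_mult_cnj: "(\<Sum>j\<in>UNIV. z $ j * cnj (z $ j)) = complex_of_real ((norm z)\<^sup>2)"
  by (simp add: norm_vec_def L2_set_def sum_nonneg complex_norm_square del: of_real_power)

lemma ball_h_diagonal: "ball_h z z = complex_of_real (1 - (norm z)\<^sup>2)"
  by (simp add: ball_h_def sum_mult_cnj)

text \<open>Along a unit direction the ball metric is the Poincare metric of the disc, so the factor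
  \<open>k\<close> of the isometry becomes the \<open>k\<close> of
  \<open>disc_potential\<close>.\<close>

lemma ball_metric_line:
  assumes e: "norm e = 1" and z: "z \<in> ball 0 1"
  shows "ball_metric (z *s e) e e = 1 / (1 - z * cnj z)\<^sup>2"
proof -
  have ee: "(\<Sum>j\<in>UNIV. e $ j * cnj (e $ j)) = 1"
    using e by (simp add: sum_mult_cnj)
  have norm: "norm (z *s e) = norm z"
    using e by (simp add: norm_vector_smult)
  have "(norm x)\<^sup>2 < 1" if "norm x < 1" for x :: "complex^'a"
    using that by (simp add: power_less_one_iff abs_square_less_1)
  then have pos: "Re (ball_h x x) > 0" if "x \<in> ball 0 1" for x :: "complex^'a"
    using that by (simp add: ball_h_diagonal)
  have h: "ball_h (z *s e) (z *s e) = 1 - z * cnj z"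
    by (simp add: ball_h_diagonal norm complex_norm_square del: of_real_power)
  have "ddbar (\<lambda>w. ln (Re (ball_h w w))) (z *s e) e e =
      (ball_h (z *s e) (z *s e) * (\<Sum>j\<in>UNIV. of_real (-1) * e $ j * cnj (e $ j))
      - (\<Sum>j\<in>UNIV. of_real (-1) * (z *s e) $ j * cnj (e $ j))
      * (\<Sum>j\<in>UNIV. of_real (-1) * e $ j * cnj ((z *s e) $ j))) / (ball_h (z *s e) (z *s e))\<^sup>2"
  proof (rule ddbar_log[where S = "ball 0 1"])
    show "complex_differential (\<lambda>z. z $ j) (\<lambda>z v. v $ j)" for j :: 'a
      by (auto simp: complex_differential_def bounded_linear_imp_has_derivative bounded_linear_vec_nth)
  qed (use z pos norm in \<open>auto simp: ball_h_def sum_negf intro: poly_fun.const\<close>)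
  also have "\<dots> = (- (1 - z * cnj z) - z * cnj z) / (1 - z * cnj z)\<^sup>2"
  proof -
    have 1: "(\<Sum>j\<in>UNIV. of_real (-1) * e $ j * cnj (e $ j)) = -1"
      using ee by (simp add: sum_negf)
    have "(\<Sum>j\<in>UNIV. of_real (-1) * (z *s e) $ j * cnj (e $ j)) = - z * (\<Sum>j\<in>UNIV. e $ j * cnj (e $ j))"
      by (simp add: sum_distrib_left sum_negf mult.assoc)
    then have 2: "(\<Sum>j\<in>UNIV. of_real (-1) * (z *s e) $ j * cnj (e $ j)) = - z"
      by (simp only: ee mult_1_right)
    have "(\<Sum>j\<in>UNIV. of_real (-1) * e $ j * cnj ((z *s e) $ j)) = - cnj z * (\<Sum>j\<in>UNIV. e $ j * cnj (e $ j))"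
      by (simp add: sum_distrib_left sum_negf mult.left_commute)
    then have 3: "(\<Sum>j\<in>UNIV. of_real (-1) * e $ j * cnj ((z *s e) $ j)) = - cnj z"
      by (simp only: ee mult_1_right)
    show ?thesis unfolding 1 2 3 h by simp
  qed
  also have "\<dots> = - (1 / (1 - z * cnj z)\<^sup>2)"
    by simp
  finally show ?thesis
    by (simp add: log_metric_def)
qed

section \<open>The functional equation of an isometric embedding\<close>

text \<open>\<open>Inl j\<close> stands for the coordinate \<open>z\<^sub>j\<close> and \<open>Inr l\<close> for the higher order polynomial \<open>G\<^sub>l\<close>.\<close>

locale potential_expansion =
  fixes h :: "complex^'N \<Rightarrow> complex^'N \<Rightarrow> complex" and L :: nat
    and A :: "'N + nat \<Rightarrow> complex^'N \<Rightarrow> complex"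
    and A' :: "'N + nat \<Rightarrow> complex^'N \<Rightarrow> complex^'N \<Rightarrow> complex" and \<epsilon> :: "'N + nat \<Rightarrow> real"
  assumes A: "complex_differential (A l) (A' l)" "poly_fun (\<lambda>z. A' l z v)" "A l 0 = 0"
    and coords: "A (Inl j) = (\<lambda>z. z $ j)" "A' (Inl j) = (\<lambda>z v. v $ j)" "\<epsilon> (Inl j) = - 1"
    and higher: "A' (Inr m) 0 v = 0"
    and h_eq: "h z w = 1 + (\<Sum>l\<in>UNIV <+> {..<L}. of_real (\<epsilon> l) * A l z * cnj (A l w))"

lemma h_polynomial_expansion:
  fixes \<Omega> :: "(complex^'N) set"
  assumes "h_polynomial \<Omega> g h"
  shows "\<exists>L A A' \<epsilon>. potential_expansion h L A A' \<epsilon>"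
proof -
  obtain L :: nat and d G where G: "\<And>l. l < L \<Longrightarrow> 2 \<le> d l \<and> homogeneous_poly (d l) (G l)"
    and h: "\<And>z \<xi>. h z \<xi> = 1 - (\<Sum>j\<in>UNIV. z $ j * cnj (\<xi> $ j))
                      + (\<Sum>l<L. (- 1) ^ d l * G l z * cnj (G l \<xi>))"
    using assms unfolding h_polynomial_def by blast
  \<comment> \<open>Padding by zero makes the properties of the family hold for every index, as the
    locale demands; the sum in \<open>h_eq\<close> still stops at \<open>L\<close>.\<close>
  define F where "F = (\<lambda>l. if l < L then G l else (\<lambda>z. 0))"
  have "\<exists>F'. complex_differential (F l) F' \<and> (\<forall>v. poly_fun (\<lambda>z. F' z v)) \<and> (\<forall>v. F' 0 v = 0)" for l
  proof (cases "l < L")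
    case True
    then show ?thesis
      using poly_fun_differential[OF homogeneous_poly_poly_fun] homogeneous_poly_differential_zero G[OF True]
      by (metis F_def)
  next
    case False
    then show ?thesis
      by (intro exI[of _ "\<lambda>z v. 0"]) (auto simp: F_def complex_differential_def intro: poly_fun.const)
  qed
  then obtain F' where F': "\<And>l. complex_differential (F l) (F' l)" "\<And>l v. poly_fun (\<lambda>z. F' l z v)"
    "\<And>l v. F' l 0 v = 0"
    by metis
  have F0: "F l 0 = 0" for l
    using homogeneous_poly_scale[of "d l" "G l" 0 0] G[of l] by (auto simp: F_def power_0_left)
  define A where "A = case_sum (\<lambda>(j::'N) z. z $ j) F"
  define A' where "A' = case_sum (\<lambda>(j::'N) z v. v $ j) F'"
  define \<epsilon> where "\<epsilon> = case_sum (\<lambda>j::'N. - 1) (\<lambda>l. (- 1 :: real) ^ d l)"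
  have "complex_differential (A l) (A' l) \<and> (\<forall>v. poly_fun (\<lambda>z. A' l z v)) \<and> A l 0 = 0" for l
    by (cases l) (auto simp: A_def A'_def F' F0 complex_differential_def intro: poly_fun.const
        bounded_linear_imp_has_derivative bounded_linear_vec_nth F'(1)[unfolded complex_differential_def, THEN conjunct1, rule_format]
        F'(1)[unfolded complex_differential_def, THEN conjunct2, rule_format])
  moreover have "h z w = 1 + (\<Sum>l\<in>(UNIV :: 'N set) <+> {..<L}. of_real (\<epsilon> l) * A l z * cnj (A l w))" for z w
    by (simp add: h sum.Plus A_def \<epsilon>_def F_def sum_negf)
  ultimately have "potential_expansion h L A A' \<epsilon>"
    by unfold_locales (auto simp: A_def A'_def \<epsilon>_def F')
  then show ?thesis
    by blast
qed

context potential_expansion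
begin

text \<open>\<open>h\<close> is real on the diagonal and equals 1 at the origin. Were it nonpositive
  somewhere, connectedness would produce a zero, contradicting that the kernel times a positive
  power of \<open>h\<close> is a positive constant.\<close>

lemma h_polynomial_pos:
  assumes h: "h_polynomial \<Omega> g h" and \<Omega>: "connected \<Omega>" "0 \<in> \<Omega>" and z: "z \<in> \<Omega>"
  shows "Re (h z z) > 0"
proof (rule ccontr)
  assume neg: "\<not> Re (h z z) > 0"
  have cont: "continuous_on \<Omega> (A l)" for l
    using A(1) unfolding complex_differential_def
    by (intro continuous_at_imp_continuous_on) (auto intro: has_derivative_continuous)
  have "continuous_on \<Omega> (\<lambda>z. Re (h z z))"
    unfolding h_eq by (intro continuous_intros cont)
  then have "connected ((\<lambda>z. Re (h z z)) ` \<Omega>)"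
    using \<Omega>(1) by (rule connected_continuous_image)
  moreover have "Re (h 0 0) = 1"
    using A by (simp add: h_eq)
  ultimately have "0 \<in> (\<lambda>z. Re (h z z)) ` \<Omega>"
    using connectedD_interval[of "(\<lambda>z. Re (h z z)) ` \<Omega>" "Re (h z z)" "Re (h 0 0)" 0] neg z \<Omega>(2) by auto
  then obtain x where x: "x \<in> \<Omega>" "Re (h x x) = 0"
    by auto
  have "Im (h x x) = 0"
    by (simp add: h_eq mult.assoc flip: complex_norm_square)
  then have "h x x = 0"
    using x(2) by (simp add: complex_eq_iff)
  moreover obtain K and c :: real and p :: nat where "c > 0" "p > 0" "K x x * h x x ^ p = of_real c"
    using h x(1) unfolding h_polynomial_def by blast
  ultimately show False
    by (cases p) simp_all
qed

text \<open>The isometry is evaluated only on the tangent vector of the disc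
  \<open>t \<mapsto> t *s e\<close> through \<open>z\<close>, which turns it into the hypothesis
  \<open>curv\<close> of \<open>disc_potential\<close>.\<close>

lemma isometry_identity_diagonal:
  fixes f :: "complex^'n \<Rightarrow> complex^'N"
  assumes h: "h_polynomial \<Omega> g h" and \<Omega>: "open \<Omega>" "connected \<Omega>" "0 \<in> \<Omega>" and k: "1 \<le> k"
    and f: "holo_isometric_embedding (ball 0 1) ball_metric (real k) \<Omega> g f" and f0: "f 0 = 0"
    and z: "z \<in> ball 0 1"
  shows "h (f z) (f z) = ball_h z z ^ k"
proof -
  have holo: "holo_map (ball 0 1) f" and f\<Omega>: "\<And>z. z \<in> ball 0 1 \<Longrightarrow> f z \<in> \<Omega>"
    and iso: "\<And>z u v. z \<in> ball 0 1 \<Longrightarrow> g (f z) (cjacobian f z *v u) (cjacobian f z *v v) = of_real k * ball_metric z u v"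
    using f by (auto simp: holo_isometric_embedding_def holomorphic_embedding_def)
  have g: "g z u v = log_metric h z u v" if "z \<in> \<Omega>" for z u v
    using h that by (simp add: h_polynomial_def)
  \<comment> \<open>The point \<open>z\<close> has parameter \<open>norm z\<close> on the line; for
    \<open>z = 0\<close> any unit vector serves as direction.\<close>
  define e where "e = (if z = 0 then axis undefined 1 else inverse (of_real (norm z)) *s z)"
  have e: "norm e = 1" "z = of_real (norm z) *s e"
    by (auto simp: e_def norm_vector_smult norm_inverse norm_axis_1)
  have line: "t *s e \<in> ball 0 1 \<longleftrightarrow> t \<in> ball 0 1" for t
    by (simp add: norm_vector_smult e)
  define a where "a = (\<lambda>l t. A l (f (t *s e)))"
  have a': "(a l has_field_derivative A' l (f (t *s e)) (cjacobian f (t *s e) *v e)) (at t)" if "t \<in> ball 0 1" for l t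
    unfolding a_def
    using complex_differential_curve[OF A(1) holo_map_has_derivative_line[OF holo, of 0 t e]] that line
    by simp
  then have da: "deriv (a l) t = A' l (f (t *s e)) (cjacobian f (t *s e) *v e)" if "t \<in> ball 0 1" for l t
    using that by (blast intro: DERIV_imp_deriv)
  have curv: "((1 + (\<Sum>l\<in>UNIV <+> {..<L}. of_real (\<epsilon> l) * a l t * cnj (a l t)))
       * (\<Sum>l\<in>UNIV <+> {..<L}. of_real (\<epsilon> l) * deriv (a l) t * cnj (deriv (a l) t))
      - (\<Sum>l\<in>UNIV <+> {..<L}. of_real (\<epsilon> l) * a l t * cnj (deriv (a l) t))
       * (\<Sum>l\<in>UNIV <+> {..<L}. of_real (\<epsilon> l) * deriv (a l) t * cnj (a l t))) * (1 - t * cnj t)\<^sup>2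
    = - of_nat k * (1 + (\<Sum>l\<in>UNIV <+> {..<L}. of_real (\<epsilon> l) * a l t * cnj (a l t)))\<^sup>2"
    (is "?X * _ = - of_nat k * ?H\<^sup>2") if t: "t \<in> ball 0 1" for t
  proof -
    let ?z = "t *s e"
    let ?v = "cjacobian f ?z *v e"
    have z: "?z \<in> ball 0 1" using t line by blast
    have H: "?H = h (f ?z) (f ?z)"
      by (simp add: h_eq a_def)
    have dd: "ddbar (\<lambda>w. ln (Re (h w w))) (f ?z) ?v ?v = ?X / ?H\<^sup>2"
      unfolding H da[OF t] unfolding a_def
      by (rule ddbar_log[where I = "UNIV <+> {..<L}" and h = h, OF A(1,2) h_eq \<Omega>(1)
            h_polynomial_pos[OF h \<Omega>(2,3)] f\<Omega>[OF z]])
    have "- ddbar (\<lambda>w. ln (Re (h w w))) (f ?z) ?v ?v = of_nat k * (1 / (1 - t * cnj t)\<^sup>2)"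
      using iso[OF z, of e e] ball_metric_line[OF e(1) t] g[OF f\<Omega>[OF z], of ?v ?v]
      by (simp add: log_metric_def[of h])
    from arg_cong[OF this, of uminus]
    have "?X / ?H\<^sup>2 = - (of_nat k * (1 / (1 - t * cnj t)\<^sup>2))"
      unfolding dd minus_minus .
    moreover have "?H \<noteq> 0"
      using h_polynomial_pos[OF h \<Omega>(2,3) f\<Omega>[OF z]] unfolding H by auto
    moreover have "1 - t * cnj t \<noteq> 0"
      by (rule one_minus_mult_cnj_nonzero[OF t t])
    moreover have "x * v\<^sup>2 = - y * u\<^sup>2" if "x / u\<^sup>2 = - (y * (1 / v\<^sup>2))" "u \<noteq> 0" "v \<noteq> 0" for x y u v :: complex
      using that by (simp add: divide_simps)
    ultimately show ?thesis by blast
  qed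
  have "1 + (\<Sum>l\<in>UNIV <+> {..<L}. of_real (\<epsilon> l) * a l (of_real (norm z)) * cnj (a l (of_real (norm z))))
      = (1 - of_real (norm z) * cnj (of_real (norm z))) ^ k"
  proof (rule disc_potential[OF _ _ k curv])
    show "a l holomorphic_on ball 0 1" for l
      using a' by (meson holomorphic_on_open open_ball)
    show "a l 0 = 0" for l
      by (simp add: a_def f0 A)
  qed (use z in auto)
  then show ?thesis
    by (simp add: h_eq a_def e(2)[symmetric] ball_h_diagonal power2_eq_square)
qed

text \<open>Two points lie on a common complex line, so polarization in one variable suffices.\<close>

lemma isometry_identity:
  fixes f :: "complex^'n \<Rightarrow> complex^'N"
  assumes h: "h_polynomial \<Omega> g h" and \<Omega>: "open \<Omega>" "connected \<Omega>" "0 \<in> \<Omega>" and k: "1 \<le> k"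
    and f: "holo_isometric_embedding (ball 0 1) ball_metric (real k) \<Omega> g f" and f0: "f 0 = 0"
    and z: "z \<in> ball 0 1" and w: "w \<in> ball 0 1"
  shows "h (f z) (f w) = ball_h z w ^ k"
proof -
  have holo: "holo_map (ball 0 1) f"
    using f by (simp add: holo_isometric_embedding_def holomorphic_embedding_def)
  define e where "e = z - w"
  \<comment> \<open>The parameters 0 and 1 give \<open>w\<close> and \<open>z\<close>. Centring the
    ball at \<open>- w\<close> makes \<open>D\<close> the preimage of a convex set under a linear
    map, hence convex.\<close>
  define D where "D = (\<lambda>t. t *s e) -` ball (- w) 1"
  have D: "t \<in> D \<longleftrightarrow> w + t *s e \<in> ball 0 1" for t
    by (simp add: D_def dist_norm norm_minus_commute[of "- w"] add.commute)
  have "open D"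
    unfolding D_def
    by (intro open_vimage open_ball linear_continuous_on[OF bounded_linear_vec_smult])
  moreover have "connected D"
    unfolding D_def
    by (intro convex_connected convex_linear_vimage convex_ball
        bounded_linear.linear[OF bounded_linear_vec_smult])
  moreover have "sesqui D (\<lambda>t s. h (f (w + t *s e)) (f (w + s *s e)) - ball_h (w + t *s e) (w + s *s e) ^ k)"
  proof -
    have "((\<lambda>t. A l (f (w + t *s e))) has_field_derivative
        A' l (f (w + t *s e)) (cjacobian f (w + t *s e) *v e)) (at t)" if "t \<in> D" for l t
      using that D by (intro complex_differential_curve A holo_map_has_derivative_line[OF holo]) blast
    then have "(\<lambda>t. A l (f (w + t *s e))) holomorphic_on D" for l
      using \<open>open D\<close> by (meson holomorphic_on_open)
    moreover have "(\<lambda>t. (w + t *s e) $ j) holomorphic_on D" for j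
      by (simp, intro holomorphic_intros)
    ultimately show ?thesis
      unfolding h_eq ball_h_def
      by (intro sesqui_intros)
  qed
  moreover have "h (f (w + t *s e)) (f (w + t *s e)) - ball_h (w + t *s e) (w + t *s e) ^ k = 0" if "t \<in> D" for t
    using isometry_identity_diagonal[OF h \<Omega> k f f0] that D by simp
  moreover have "1 \<in> D" "0 \<in> D"
    using z w by (simp_all add: D e_def)
  ultimately have "h (f (w + 1 *s e)) (f (w + 0 *s e)) - ball_h (w + 1 *s e) (w + 0 *s e) ^ k = 0"
    by (rule sesqui_polarization)
  then show ?thesis
    by (simp add: e_def)
qed

lemma ctranspose_jacobian:
  fixes f :: "complex^'n \<Rightarrow> complex^'N"
  assumes h: "h_polynomial \<Omega> g h" and \<Omega>: "open \<Omega>" "connected \<Omega>" "0 \<in> \<Omega>" and k: "1 \<le> k"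
    and f: "holo_isometric_embedding (ball 0 1) ball_metric (real k) \<Omega> g f" and f0: "f 0 = 0"
    and z: "z \<in> ball 0 1"
  shows "ctranspose (cjacobian f 0) *v f z = of_nat k *s z"
proof -
  have holo: "holo_map (ball 0 1) f"
    using f by (simp add: holo_isometric_embedding_def holomorphic_embedding_def)
  have "(ctranspose (cjacobian f 0) *v f z) $ b = of_nat k * z $ b" for b
  proof -
    let ?e = "axis b 1 :: complex^'n"
    let ?v = "cjacobian f 0 *v ?e"
    have d: "((\<lambda>t. A l (f (t *s ?e))) has_field_derivative A' l 0 ?v) (at 0)" for l
      using complex_differential_curve[OF A(1) holo_map_has_derivative_line[OF holo, of 0 0 ?e], of l]
      by (simp add: f0)
    \<comment> \<open>The sum is the conjugate of \<open>h (f z) (f (t *s ?e))\<close>, and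
      conjugation makes it holomorphic in \<open>t\<close>.\<close>
    have sum: "((\<lambda>t. 1 + (\<Sum>l\<in>UNIV <+> {..<L}. of_real (\<epsilon> l) * cnj (A l (f z)) * A l (f (t *s ?e))))
        has_field_derivative (\<Sum>l\<in>UNIV <+> {..<L}. of_real (\<epsilon> l) * cnj (A l (f z)) * A' l 0 ?v)) (at 0)"
      by (rule derivative_eq_intros d refl)+ (simp add: mult.commute)
    have power: "1 + (\<Sum>l\<in>UNIV <+> {..<L}. of_real (\<epsilon> l) * cnj (A l (f z)) * A l (f (t *s ?e)))
        = (1 - t * cnj (z $ b)) ^ k" if t: "t \<in> ball 0 1" for t
    proof -
      have "t *s ?e \<in> ball 0 1"
        using t by (simp add: norm_vector_smult norm_axis_1)
      then have "cnj (h (f z) (f (t *s ?e))) = cnj (ball_h z (t *s ?e) ^ k)"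
        using isometry_identity[OF h \<Omega> k f f0 z] by simp
      then show ?thesis
        by (simp add: h_eq ball_h_def axis_def if_distrib if_distribR ac_simps cong: if_cong)
    qed
    have "((\<lambda>t. (1 - t * cnj (z $ b)) ^ k) has_field_derivative
        (\<Sum>l\<in>UNIV <+> {..<L}. of_real (\<epsilon> l) * cnj (A l (f z)) * A' l 0 ?v)) (at 0)"
      by (rule has_field_derivative_transform_within_open[OF sum open_ball _ power])
        (rule centre_in_ball[THEN iffD2, OF zero_less_one])
    moreover have "((\<lambda>t. (1 - t * cnj (z $ b)) ^ k) has_field_derivative - (of_nat k * cnj (z $ b))) (at 0)"
      by (rule derivative_eq_intros refl)+ simp
    ultimately have "(\<Sum>l\<in>UNIV <+> {..<L}. of_real (\<epsilon> l) * cnj (A l (f z)) * A' l 0 ?v) = - (of_nat k * cnj (z $ b))"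
      by (rule DERIV_unique)
    moreover have "?v $ j = cjacobian f 0 $ j $ b" for j
      by (simp add: matrix_vector_mult_def axis_def if_distrib cong: if_cong)
    \<comment> \<open>The higher order terms drop out by \<open>higher\<close>; the sign
      \<open>- 1\<close> of the coordinate terms cancels that from differentiating the
      power.\<close>
    ultimately have "(\<Sum>j\<in>UNIV. cnj (f z $ j) * cjacobian f 0 $ j $ b) = of_nat k * cnj (z $ b)"
      by (simp add: sum.Plus coords higher sum_negf)
    then have "cnj (\<Sum>j\<in>UNIV. cnj (f z $ j) * cjacobian f 0 $ j $ b) = cnj (of_nat k * cnj (z $ b))"
      by simp
    then show ?thesis
      by (simp add: ctranspose_def matrix_vector_mult_def mult.commute)
  qed
  then show ?thesis
    by (simp add: vec_eq_iff)
qed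

text \<open>Differentiate the identity of \<open>ctranspose_jacobian\<close> along
  \<open>t *s x\<close> at \<open>t = 0\<close>. The set \<open>S\<close> keeps
  \<open>t *s x\<close> in the ball for a vector \<open>x\<close> of any length.\<close>

lemma scaled_isometry_jacobian:
  fixes f :: "complex^'n \<Rightarrow> complex^'N"
  assumes h: "h_polynomial \<Omega> g h" and \<Omega>: "open \<Omega>" "connected \<Omega>" "0 \<in> \<Omega>" and k: "1 \<le> k"
    and f: "holo_isometric_embedding (ball 0 1) ball_metric (real k) \<Omega> g f" and f0: "f 0 = 0"
  shows "scaled_isometry (cjacobian f 0) (of_nat k)"
proof
  show "of_nat k \<noteq> (0 :: complex)"
    using k by simp
  fix x :: "complex^'n"
  let ?J = "cjacobian f 0"
  define S where "S = (\<lambda>t. t *s x) -` ball 0 1"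
  have S: "open S" "0 \<in> S"
    unfolding S_def
    by (auto intro!: open_vimage open_ball linear_continuous_on[OF bounded_linear_vec_smult])
  have holo: "holo_map (ball 0 1) f"
    using f by (simp add: holo_isometric_embedding_def holomorphic_embedding_def)
  have "((\<lambda>t. f (t *s x)) has_derivative (\<lambda>s. s *s (?J *v x))) (at 0)"
    using holo_map_has_derivative_line[OF holo, of 0 0 x] by simp
  moreover have "bounded_linear ((*v) (ctranspose ?J))"
    by (intro linear_conv_bounded_linear[THEN iffD1] matrix_vector_mul_linear)
  ultimately have "((\<lambda>t. ctranspose ?J *v f (t *s x)) has_derivative
      (\<lambda>s. ctranspose ?J *v (s *s (?J *v x)))) (at 0)"
    by (rule bounded_linear.has_derivative[rotated])
  then have "((\<lambda>t. t *s (of_nat k *s x)) has_derivative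
      (\<lambda>s. ctranspose ?J *v (s *s (?J *v x)))) (at 0)"
    by (rule has_derivative_transform_within_open[OF _ S])
      (simp add: S_def ctranspose_jacobian[OF assms] mult.commute)
  then have "(\<lambda>s. ctranspose ?J *v (s *s (?J *v x))) = (\<lambda>s. s *s (of_nat k *s x))"
    using bounded_linear_imp_has_derivative[OF bounded_linear_vec_smult] by (rule has_derivative_unique)
  from fun_cong[OF this, of 1] show "ctranspose ?J *v (?J *v x) = of_nat k *s x"
    by simp
qed

end

section \<open>Images of affine subspaces\<close>

lemma f_sharp_eq:
  assumes V: "V \<in> grassmannian m"
  shows "f_sharp f m V = {w. ctranspose (cjacobian f 0) *v w \<in> V}"
proof -
  obtain A where "full_rank_rows (CARD('a) - m) A" "V = rows_ker A"
    using rows_ker_exists[of V] V by (auto simp: grassmannian_def)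
  then show ?thesis
    unfolding f_sharp_def by (intro the_equality) (auto simp: rows_ker_rows_mult)
qed

lemma mem_translate_iff:
  fixes q :: "'a::ab_group_add"
  shows "y \<in> (\<lambda>x. x + q) ` W \<longleftrightarrow> y - q \<in> W"
  by (auto intro: image_eqI[of _ _ "y - q"])

theorem proposition2p1:
  fixes \<Omega> :: "(complex^'N) set" and g :: "'N metric"
    and h :: "complex^'N \<Rightarrow> complex^'N \<Rightarrow> complex"
    and f :: "complex^'n \<Rightarrow> complex^'N" and k :: nat
  assumes "irreducible_bsd \<Omega>" and "harish_chandra_realization \<Omega>"
    and "canonical_KE_metric \<Omega> g" and "h_polynomial \<Omega> g h"
    and "1 \<le> k" and "k \<le> bsd_rank \<Omega>" and "CARD('n) \<ge> 2"
    and "holo_isometric_embedding (ball 0 1) ball_metric (real k) \<Omega> g f"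
    and "f 0 = 0"
  shows "(\<forall>m. 1 \<le> m \<and> m \<le> CARD('n) - 1 \<longrightarrow>
      (\<forall>V\<in>grassmannian m. \<forall>A. full_rank_rows (CARD('n) - m) A \<and> V = rows_ker A \<longrightarrow>
           f_sharp f m V = rows_ker (rows_mult A (ctranspose (cjacobian f 0)))) \<and>
      f_sharp f m ` grassmannian m \<subseteq> grassmannian (CARD('N) - CARD('n) + m) \<and>
      inj_on (f_sharp f m) (grassmannian m) \<and>
      (\<forall>V\<in>grassmannian m.
         f_sharp f m V
           = {a + b | a b. a \<in> (*v) (cjacobian f 0) ` V \<and> b \<in> mat_ker (ctranspose (cjacobian f 0))} \<and>
         (*v) (cjacobian f 0) ` V \<inter> mat_ker (ctranspose (cjacobian f 0)) = {0} \<and>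
         (\<forall>v\<in>ball 0 1.
            f ` ((\<lambda>x. x + v) ` V \<inter> ball 0 1)
              = (\<lambda>x. x + cjacobian f 0 *v v) ` f_sharp f m V \<inter> f ` ball 0 1 \<and>
            (\<lambda>x. x + cjacobian f 0 *v v) ` f_sharp f m V \<inter> f ` ball 0 1
              \<subseteq> (\<lambda>x. x + cjacobian f 0 *v v) ` f_sharp f m V \<inter> \<Omega> \<and>
            f ` ((\<lambda>x. x + v) ` V \<inter> ball 0 1)
              = (\<lambda>x. x + f v) ` f_sharp f m V \<inter> f ` ball 0 1 \<and>
            (\<lambda>x. x + f v) ` f_sharp f m V \<inter> f ` ball 0 1
              \<subseteq> (\<lambda>x. x + f v) ` f_sharp f m V \<inter> \<Omega>)) \<and>
      (\<forall>\<Lambda>\<in>affine_subspaces m. \<Lambda> \<inter> ball 0 1 \<noteq> {} \<longrightarrow>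
         (\<exists>P\<in>affine_subspaces (CARD('N) - CARD('n) + m). f ` (\<Lambda> \<inter> ball 0 1) \<subseteq> P \<inter> \<Omega>))) \<and>
    (\<forall>\<Lambda>\<in>affine_subspaces (CARD('n) - 1). \<Lambda> \<inter> ball 0 1 \<noteq> {} \<longrightarrow>
           (\<exists>P\<in>affine_subspaces (CARD('N) - 1). f ` (\<Lambda> \<inter> ball 0 1) \<subseteq> P))"
proof -
  let ?J = "cjacobian f 0"
  have \<Omega>: "open \<Omega>" "connected \<Omega>" "0 \<in> \<Omega>"
    using assms(2) by (auto simp: harish_chandra_realization_def bounded_symmetric_domain_def)
  obtain L A A' \<epsilon> where "potential_expansion h L A A' \<epsilon>"
    using h_polynomial_expansion[OF assms(4)] by blast
  then interpret potential_expansion h L A A' \<epsilon> .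
  interpret scaled_isometry ?J "of_nat k"
    by (rule scaled_isometry_jacobian[OF assms(4) \<Omega> assms(5,8,9)])
  have Jf: "ctranspose ?J *v f x = of_nat k *s x" if "x \<in> ball 0 1" for x
    by (rule ctranspose_jacobian[OF assms(4) \<Omega> assms(5,8,9) that])
  have f\<Omega>: "f ` ball 0 1 \<subseteq> \<Omega>"
    using assms(8) by (simp add: holo_isometric_embedding_def holomorphic_embedding_def)
  have sharp: "f_sharp f m V = lift V" if "V \<in> grassmannian m" for m V
    using f_sharp_eq[OF that] by (simp add: lift_def)
  have sub: "vec.subspace V" if "V \<in> grassmannian m" for m and V :: "(complex^'n) set"
    using that by (simp add: grassmannian_def)
  \<comment> \<open>Both translations of the theorem are covered: \<open>p = ?J *v v\<close>
    satisfies the condition by \<open>JJ\<close>, and \<open>p = f v\<close> by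
    \<open>Jf\<close>.\<close>
  have image: "f ` ((\<lambda>x. x + v) ` V \<inter> ball 0 1) = (\<lambda>x. x + p) ` lift V \<inter> f ` ball 0 1"
    if V: "vec.subspace V" and p: "ctranspose ?J *v p = of_nat k *s v" for V v p
  proof -
    have scale: "of_nat k *s x \<in> V \<longleftrightarrow> x \<in> V" for x
      using mem_lift[OF V, of x] by (simp add: lift_def JJ)
    have "f x - p \<in> lift V \<longleftrightarrow> x - v \<in> V" if "x \<in> ball 0 1" for x
      using scale[of "x - v"] by (simp add: lift_def vec.diff Jf[OF that] p vector_ssub_ldistrib)
    then have "{x \<in> ball 0 1. x - v \<in> V} = {x \<in> ball 0 1. f x - p \<in> lift V}"
      by blast
    moreover have "(\<lambda>x. x + v) ` V \<inter> ball 0 1 = {x \<in> ball 0 1. x - v \<in> V}"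
      by (auto simp: mem_translate_iff)
    moreover have "(\<lambda>x. x + p) ` lift V \<inter> f ` ball 0 1 = f ` {x \<in> ball 0 1. f x - p \<in> lift V}"
      by (rule set_eqI) (simp only: Int_iff mem_translate_iff, blast)
    ultimately show ?thesis
      by simp
  qed
  have lift_grass: "lift V \<in> grassmannian (CARD('N) - CARD('n) + m)" if "V \<in> grassmannian m" for m V
    using dim_lift[OF sub[OF that]] that card_le subspace_lift[OF sub[OF that]]
    by (simp add: grassmannian_def)
  have inj: "V = W" if "V \<in> grassmannian m" "W \<in> grassmannian m" "lift V = lift W" for m V W
    using mem_lift[OF sub[OF that(1)]] mem_lift[OF sub[OF that(2)]] that(3) by blast
  have affine: "\<exists>P\<in>affine_subspaces (CARD('N) - CARD('n) + m). f ` (\<Lambda> \<inter> ball 0 1) \<subseteq> P \<inter> \<Omega>"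
    if \<Lambda>: "\<Lambda> \<in> affine_subspaces m" "\<Lambda> \<inter> ball 0 1 \<noteq> {}" for m and \<Lambda> :: "(complex^'n) set"
  proof -
    obtain p V where V: "\<Lambda> = (+) p ` V" "V \<in> grassmannian m"
      using \<Lambda>(1) by (auto simp: affine_subspaces_def)
    \<comment> \<open>The given base point \<open>p\<close> may lie outside the ball, where
      \<open>Jf\<close> says nothing; \<open>p + v\<close> is a base point of the same affine
      subspace inside it.\<close>
    obtain v where v: "p + v \<in> ball 0 1" "v \<in> V"
      using \<Lambda>(2) V(1) by auto
    have "\<Lambda> \<subseteq> (\<lambda>x. x + (p + v)) ` V"
    proof
      fix y assume "y \<in> \<Lambda>"
      then obtain u where "u \<in> V" "y = p + u" using V(1) by auto
      then show "y \<in> (\<lambda>x. x + (p + v)) ` V"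
        using v(2) vec.subspace_diff[OF sub[OF V(2)]] by (intro image_eqI[of _ _ "u - v"]) auto
    qed
    then have "f ` (\<Lambda> \<inter> ball 0 1) \<subseteq> (\<lambda>x. x + f (p + v)) ` lift V"
      using image[OF sub[OF V(2)] Jf[OF v(1)]] by blast
    moreover have "(\<lambda>x. x + f (p + v)) ` lift V = (+) (f (p + v)) ` lift V"
      by (simp add: add.commute)
    moreover have "(+) (f (p + v)) ` lift V \<in> affine_subspaces (CARD('N) - CARD('n) + m)"
      using lift_grass[OF V(2)] by (auto simp: affine_subspaces_def)
    ultimately show ?thesis
      using f\<Omega> by (intro bexI[of _ "(+) (f (p + v)) ` lift V"]) auto
  qed
  \<comment> \<open>Hyperplanes are the case \<open>m = CARD('n) - 1\<close>.\<close>
  have "CARD('N) - CARD('n) + (CARD('n) - 1) = CARD('N) - 1"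
    using card_le assms(7) by simp
  then have hyper: "\<exists>P\<in>affine_subspaces (CARD('N) - 1). f ` (\<Lambda> \<inter> ball 0 1) \<subseteq> P"
    if "\<Lambda> \<in> affine_subspaces (CARD('n) - 1)" "\<Lambda> \<inter> ball 0 1 \<noteq> {}" for \<Lambda> :: "(complex^'n) set"
    using affine[OF that] by auto
  show ?thesis
  proof (intro conjI allI impI ballI)
    fix m and V :: "(complex^'n) set" and A
    assume "V \<in> grassmannian m" "full_rank_rows (CARD('n) - m) A \<and> V = rows_ker A"
    then show "f_sharp f m V = rows_ker (rows_mult A (ctranspose ?J))"
      by (simp add: sharp lift_def rows_ker_rows_mult)
  next
    show "f_sharp f m ` grassmannian m \<subseteq> grassmannian (CARD('N) - CARD('n) + m)" for m
      using lift_grass by (auto simp: sharp)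
  next
    show "inj_on (f_sharp f m) (grassmannian m)" for m
      by (rule inj_onI) (simp add: sharp inj)
  next
    fix m and V :: "(complex^'n) set" assume V: "V \<in> grassmannian m"
    show "f_sharp f m V = {a + b | a b. a \<in> (*v) ?J ` V \<and> b \<in> mat_ker (ctranspose ?J)}"
      unfolding sharp[OF V] by (rule lift_eq_sum[OF sub[OF V]])
    show "(*v) ?J ` V \<inter> mat_ker (ctranspose ?J) = {0}"
      by (rule image_Int_ker[OF sub[OF V]])
    fix v :: "complex^'n" assume v: "v \<in> ball 0 1"
    show "f ` ((\<lambda>x. x + v) ` V \<inter> ball 0 1) = (\<lambda>x. x + ?J *v v) ` f_sharp f m V \<inter> f ` ball 0 1"
      unfolding sharp[OF V] by (rule image[OF sub[OF V] JJ])
    show "f ` ((\<lambda>x. x + v) ` V \<inter> ball 0 1) = (\<lambda>x. x + f v) ` f_sharp f m V \<inter> f ` ball 0 1"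
      unfolding sharp[OF V] by (rule image[OF sub[OF V] Jf[OF v]])
  qed (use affine hyper f\<Omega> in blast)+
qed

end
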